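(* Let $W_i=(M_i,A_i,X_i,U_i)$ be i.i.d. with law $P$, with associated ground truth variable $M_i^*$, $E[|M_i|]<\infty$, and let $\theta=E[M_i^*]$. Put $\tilde X_i=(X_i,U_i)$ and $\mu(\tilde x)=E[M_i\mid A_i=1,\tilde X_i=\tilde x]$. Let $\mathcal I,\mathcal I'$ be the disjoint index sets of a random sample split, let $\hat\mu$ be an estimator of $\mu$ that is a function of $\{W_{i'}\}_{i'\in\mathcal I'}$ only, and let \[ \hat\theta=\frac1{|\mathcal I|}\sum_{i\in\mathcal I}\Bigl[\hat\mu(\tilde X_i)+\frac{A_i}{\pi(X_i)}\bigl(M_i-\hat\mu(\tilde X_i)\bigr)\Bigr]. \] Assume: (1) $M_i=A_iM_i^*$ with $A_i\in\{0,1\}$; (2) $(U_i,M_i^* )$ is conditionally independent of $A_i$ given $X_i$; (3) $\pi(x)=P(A_i=1\mid X_i=x)$ is fixed, known, and $\pi(x)\in[\eta,1]$ for all $x$, for some $0<\eta<1$; (4) $E\bigl[\int(\hat\mu(\tilde x)-\mu(\tilde x))^2\,dP_{\tilde X}(\tilde x)\bigr]=o(1)$ as $|\mathcal I'|\to\infty$. Then, as $|\mathcal I|,|\mathcal I'|\to\infty$, \[ \sqrt{|\mathcal I|}\,(\hat\theta-\theta)\xrightarrow{d}N\bigl(0,\mathrm{Var}(\varphi(W_i))\bigr),\qquad \varphi(W_i)=\mu(\tilde X_i)+\frac{A_i}{\pi(X_i)}\bigl(M_i-\mu(\tilde X_i)\bigr)-\theta . \]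
   Context: $M_i$ is real-valued, $X_i\in\mathbb R^k$ are observed covariates, $U_i\in\mathbb R^\ell$ are unstructured data, $A_i$ is an annotation indicator. $P_{\tilde X}$ is the law of $\tilde X_i$. Because of the random split, $\{W_i\}_{i\in\mathcal I}$ and $\{W_{i'}\}_{i'\in\mathcal I'}$ may be regarded as two independent i.i.d. samples from $P$. Here $\varphi$ is the efficient influence function of $\theta=E_P[\mu(\tilde X_i)]$ under the semiparametric model in which the annotation score $\pi$ is known, so the asymptotic variance is the semiparametric variance lower bound.
   Formalization: The formal theorem additionally assumes that φ(W_i) has a finite second moment; E|M_i|<∞ and (1)–(4) do not imply Var(φ(W_i))<∞, and without it the limit N(0,Var(φ(W_i))) is undefined. *)

theory Defs
  imports "HOL-Probability.Probability"
begin

text \<open>\<open>features\<close> holds $(X, U)$, \<open>obs\<close> holds $W = (M, A, X, U)$.\<close>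

type_synonym ('k, 'l) features = "(real ^ 'k) \<times> (real ^ 'l)"

type_synonym ('k, 'l) obs = "real \<times> real \<times> (real ^ 'k) \<times> (real ^ 'l)"

text \<open>\<open>f\<close> is a (Borel) version of the regression function $v \mapsto E_Q[Y \mid V = v]$.\<close>

definition is_cond_exp_fun ::
  "'w measure \<Rightarrow> ('w \<Rightarrow> real) \<Rightarrow> ('w \<Rightarrow> 'b::topological_space) \<Rightarrow> ('b \<Rightarrow> real) \<Rightarrow> bool"
where
  "is_cond_exp_fun Q Y V f \<longleftrightarrow>
     f \<in> borel_measurable borel \<and>
     (AE \<omega> in Q. real_cond_exp Q (vimage_algebra (space Q) V borel) Y \<omega> = f (V \<omega>))"

text \<open>\<open>Y\<close> and \<open>Z\<close> are conditionally independent given \<open>V\<close>, i.e. almost surely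
  $Q(Y \in B, Z \in C \mid V) = Q(Y \in B \mid V)\, Q(Z \in C \mid V)$ for all Borel $B$, $C$.\<close>

definition cond_indep_given ::
  "'w measure \<Rightarrow> ('w \<Rightarrow> 'b::topological_space) \<Rightarrow> ('w \<Rightarrow> 'c::topological_space) \<Rightarrow>
   ('w \<Rightarrow> 'd::topological_space) \<Rightarrow> bool"
where
  "cond_indep_given Q Y Z V \<longleftrightarrow>
     (\<forall>B \<in> sets borel. \<forall>C \<in> sets borel. AE \<omega> in Q.
        real_cond_exp Q (vimage_algebra (space Q) V borel) (indicat_real (Y -` B \<inter> Z -` C)) \<omega>
        = real_cond_exp Q (vimage_algebra (space Q) V borel) (indicat_real (Y -` B)) \<omega>
          * real_cond_exp Q (vimage_algebra (space Q) V borel) (indicat_real (Z -` C)) \<omega>)"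

text \<open>$N(m, v)$; the second argument is the variance, and $N(m, 0)$ is the point mass at $m$.\<close>

definition normal_law :: "real \<Rightarrow> real \<Rightarrow> real measure" where
  "normal_law m v =
     (if v = 0 then return borel m else density lborel (normal_density m (sqrt v)))"

definition aipw_score ::
  "(real ^ 'k \<Rightarrow> real) \<Rightarrow> (('k, 'l) features \<Rightarrow> real) \<Rightarrow> ('k, 'l) obs \<Rightarrow> real"
where
  "aipw_score \<pi> f = (\<lambda>(m, a, x, u). f (x, u) + a / \<pi> x * (m - f (x, u)))"

definition aipw_estimator ::
  "(real ^ 'k \<Rightarrow> real) \<Rightarrow> (('k, 'l) features \<Rightarrow> real) \<Rightarrow> nat set \<Rightarrow> (nat \<Rightarrow> ('k, 'l) obs) \<Rightarrow> real"
where
  "aipw_estimator \<pi> f I w = (1 / real (card I)) * (\<Sum>i\<in>I. aipw_score \<pi> f (w i))"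

definition influence_fun ::
  "(real ^ 'k \<Rightarrow> real) \<Rightarrow> (('k, 'l) features \<Rightarrow> real) \<Rightarrow> real \<Rightarrow> ('k, 'l) obs \<Rightarrow> real"
where
  "influence_fun \<pi> \<mu> \<theta> w = aipw_score \<pi> \<mu> w - \<theta>"

text \<open>\<open>I n\<close>, \<open>I' n\<close> is a random split, of deterministic sizes \<open>N n\<close>, \<open>N' n\<close>, whose
  randomness is independent of the observations \<open>W\<close>.\<close>

definition random_split ::
  "'w measure \<Rightarrow> (nat \<Rightarrow> 'w \<Rightarrow> 'b::topological_space) \<Rightarrow>
   (nat \<Rightarrow> 'w \<Rightarrow> nat set) \<Rightarrow> (nat \<Rightarrow> 'w \<Rightarrow> nat set) \<Rightarrow> (nat \<Rightarrow> nat) \<Rightarrow> (nat \<Rightarrow> nat) \<Rightarrow> bool"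
where
  "random_split Q W I I' N N' \<longleftrightarrow>
     (\<forall>n. \<forall>\<omega>\<in>space Q. finite (I n \<omega>) \<and> finite (I' n \<omega>) \<and> I n \<omega> \<inter> I' n \<omega> = {} \<and>
                       card (I n \<omega>) = N n \<and> card (I' n \<omega>) = N' n) \<and>
     (\<forall>n. prob_space.indep_set Q
            (sets (vimage_algebra (space Q) (\<lambda>\<omega>. (I n \<omega>, I' n \<omega>))
                     (count_space (Collect finite \<times> Collect finite))))
            (sets (vimage_algebra (space Q) (\<lambda>\<omega> i. W i \<omega>) (PiM UNIV (\<lambda>_. borel)))))"

end

theory Submission
  imports Defs
begin

text \<open>With \<open>r f w = (1 - a / \<pi> x) f (x, u)\<close> the AIPW score satisfies
  \<open>aipw_score \<pi> f - aipw_score \<pi> \<mu> = r (f - \<mu>)\<close>, so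
  \<open>\<surd>|I| (theta_hat - \<theta>) = T + R\<close>, where \<open>T\<close> and \<open>R\<close> are \<open>1 / \<surd>|I|\<close> times the sums over \<open>I\<close>
  of the influence function and of \<open>r (mu_hat - \<mu>)\<close>.
  Conditional independence gives \<open>E[A / \<pi>(X) k(X, U, M\<^sup>*)] = E[k(X, U, M\<^sup>*)]\<close>, whence the influence function
  is centred and \<open>r f\<close> has mean zero for every \<open>f\<close> for which it is integrable. Given the split and the training sample, \<open>R\<close> is therefore
  a normalised sum of i.i.d. centred variables, so
  \<open>E[R\<^sup>2] \<le> \<eta>\<^sup>-\<^sup>2 E[\<integral> (mu_hat - \<mu>)\<^sup>2 dP\<^sub>X] \<longlonglongrightarrow> 0\<close>. The law of \<open>T\<close> depends on the split only through \<open>|I|\<close>, so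
  the central limit theorem applies to it, and \<open>R\<close> does not affect the limit.\<close>

subsection \<open>Independence and convergence in law\<close>

text \<open>Independence of the generated sigma-algebras identifies the joint law with the product
  law on rectangles, hence everywhere, and Tonelli's theorem does the rest. It replaces conditioning
  throughout: one variable is frozen at \<open>X x\<close> while the other is averaged over a fresh
  copy of the sample space. Taking \<open>f\<close> nonnegative avoids integrability
  conditions.\<close>

lemma (in prob_space) nn_integral_indep_set:
  assumes X [measurable]: "X \<in> measurable M S" and Y [measurable]: "Y \<in> measurable M T"
    and ind: "indep_set (sets (vimage_algebra (space M) X S)) (sets (vimage_algebra (space M) Y T))"
    and f [measurable]: "f \<in> borel_measurable (S \<Otimes>\<^sub>M T)"
  shows "(\<integral>\<^sup>+ x. f (X x, Y x) \<partial>M) = (\<integral>\<^sup>+ x. \<integral>\<^sup>+ y. f (X x, Y y) \<partial>M \<partial>M)"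
proof -
  interpret S: prob_space "distr M S X" by (rule prob_space_distr) simp
  interpret T: prob_space "distr M T Y" by (rule prob_space_distr) simp
  have eq: "distr M S X \<Otimes>\<^sub>M distr M T Y = distr M (S \<Otimes>\<^sub>M T) (\<lambda>x. (X x, Y x))"
  proof (rule pair_measure_eqI)
    fix A B assume A: "A \<in> sets (distr M S X)" and B: "B \<in> sets (distr M T Y)"
    have "prob ((X -` A \<inter> space M) \<inter> (Y -` B \<inter> space M))
        = prob (X -` A \<inter> space M) * prob (Y -` B \<inter> space M)"
      by (rule indep_setD[OF ind]) (use A B in \<open>auto simp: sets_vimage_algebra\<close>)
    moreover have "(\<lambda>x. (X x, Y x)) -` (A \<times> B) \<inter> space M = (X -` A \<inter> space M) \<inter> (Y -` B \<inter> space M)"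
      by auto
    ultimately show "emeasure (distr M S X) A * emeasure (distr M T Y) B
        = emeasure (distr M (S \<Otimes>\<^sub>M T) (\<lambda>x. (X x, Y x))) (A \<times> B)"
      using A B by (simp add: emeasure_distr emeasure_eq_measure ennreal_mult)
  qed (auto intro: S.sigma_finite_measure_axioms T.sigma_finite_measure_axioms)
  have "(\<integral>\<^sup>+ x. f (X x, Y x) \<partial>M) = (\<integral>\<^sup>+ p. f p \<partial>(distr M S X \<Otimes>\<^sub>M distr M T Y))"
    unfolding eq by (subst nn_integral_distr) auto
  also have "\<dots> = (\<integral>\<^sup>+ x. \<integral>\<^sup>+ y. f (x, y) \<partial>distr M T Y \<partial>distr M S X)"
    by (rule T.nn_integral_fst[symmetric]) (simp add: f cong: measurable_cong_sets)
  also have "\<dots> = (\<integral>\<^sup>+ x. \<integral>\<^sup>+ y. f (X x, y) \<partial>distr M T Y \<partial>M)"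
    by (rule nn_integral_distr) measurable
  also have "\<dots> = (\<integral>\<^sup>+ x. \<integral>\<^sup>+ y. f (X x, Y y) \<partial>M \<partial>M)"
  proof (rule nn_integral_cong)
    fix x assume "x \<in> space M"
    then have "X x \<in> space S" by (rule measurable_space[OF X])
    then show "(\<integral>\<^sup>+ y. f (X x, y) \<partial>distr M T Y) = (\<integral>\<^sup>+ y. f (X x, Y y) \<partial>M)"
      by (intro nn_integral_distr) measurable
  qed
  finally show ?thesis .
qed

text \<open>The cross term in the induction step vanishes because \<open>Y j\<close> is centred and
  independent of the partial sum. Integrability of the squared sum is carried along because the next
  step derives from it that the partial sum, and so the cross term, is integrable.\<close>

lemma (in prob_space) second_moment_sum_indep:
  fixes Y :: "'i \<Rightarrow> 'a \<Rightarrow> real"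
  assumes "finite J" "indep_vars (\<lambda>_. borel) Y J"
    and "\<And>i. i \<in> J \<Longrightarrow> integrable M (\<lambda>x. (Y i x)\<^sup>2)"
    and "\<And>i. i \<in> J \<Longrightarrow> expectation (Y i) = 0"
  shows "integrable M (\<lambda>x. (\<Sum>i\<in>J. Y i x)\<^sup>2) \<and>
    expectation (\<lambda>x. (\<Sum>i\<in>J. Y i x)\<^sup>2) = (\<Sum>i\<in>J. expectation (\<lambda>x. (Y i x)\<^sup>2))"
  using assms
proof (induction J rule: finite_induct)
  case (insert j J)
  let ?S = "\<lambda>x. \<Sum>i\<in>J. Y i x"
  have rv: "random_variable borel (Y i)" if "i \<in> insert j J" for i
    using insert.prems(1) that by (auto simp: indep_vars_def)
  have [measurable]: "Y j \<in> borel_measurable M" by (rule rv) simp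
  have [measurable]: "?S \<in> borel_measurable M" by (rule borel_measurable_sum) (auto intro: rv)
  have IH: "integrable M (\<lambda>x. (?S x)\<^sup>2)"
    "expectation (\<lambda>x. (?S x)\<^sup>2) = (\<Sum>i\<in>J. expectation (\<lambda>x. (Y i x)\<^sup>2))"
    using insert.IH insert.prems indep_vars_subset[OF insert.prems(1), of J] by auto
  have sq: "integrable M (\<lambda>x. (Y j x)\<^sup>2)" using insert.prems(2) by simp
  have int: "integrable M (Y j)" "integrable M ?S"
    by (rule square_integrable_imp_integrable[OF _ sq] square_integrable_imp_integrable[OF _ IH(1)]; simp)+
  have ind: "indep_var borel (Y j) borel ?S"
    using insert.hyps insert.prems(1) by (intro indep_vars_sum) auto
  have cross: "integrable M (\<lambda>x. Y j x * ?S x)" "expectation (\<lambda>x. Y j x * ?S x) = 0"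
    using indep_var_integrable[OF ind int] indep_var_lebesgue_integral[OF ind int] insert.prems(3)
    by auto
  have eq: "(\<Sum>i\<in>insert j J. Y i x)\<^sup>2 = (Y j x)\<^sup>2 + 2 * (Y j x * ?S x) + (?S x)\<^sup>2" for x
    using insert.hyps by (simp add: power2_eq_square algebra_simps)
  show ?case unfolding eq using sq cross IH insert.hyps by simp
qed simp

section \<open>Limit laws through characteristic functions\<close>

lemma char_distr_scale:
  fixes Y :: "'a \<Rightarrow> real"
  assumes [measurable]: "Y \<in> borel_measurable M"
  shows "char (distr M borel (\<lambda>x. c * Y x)) t = char (distr M borel Y) (t * c)"
  by (simp add: char_def integral_distr mult.assoc)

lemma cmod_iexp_diff_1_le: "cmod (iexp x - 1) \<le> \<bar>x\<bar>"
  using iexp_approx1[of x 0] by simp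

text \<open>A form of Slutsky's theorem for a perturbation that is null in L1. Factoring out the
  unimodular \<open>iexp (t * T n x)\<close> shows that the characteristic functions at
  \<open>t\<close> differ by at most |t| E|R n|, and Levy's continuity theorem concludes.\<close>

lemma (in prob_space) weak_conv_m_add_null:
  fixes T R :: "nat \<Rightarrow> 'a \<Rightarrow> real"
  assumes T[measurable]: "\<And>n. T n \<in> borel_measurable M"
    and R[measurable]: "\<And>n. R n \<in> borel_measurable M"
    and L: "real_distribution L"
    and conv: "weak_conv_m (\<lambda>n. distr M borel (T n)) L"
    and null: "(\<lambda>n. \<integral>\<^sup>+ x. ennreal \<bar>R n x\<bar> \<partial>M) \<longlonglongrightarrow> 0"
  shows "weak_conv_m (\<lambda>n. distr M borel (\<lambda>x. T n x + R n x)) L"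
proof (rule levy_continuity[OF _ L])
  show "real_distribution (distr M borel (\<lambda>x. T n x + R n x))" for n
    by (rule real_distribution_distr) simp
  fix t
  have lim: "(\<lambda>n. char (distr M borel (T n)) t) \<longlonglongrightarrow> char L t"
    by (rule levy_continuity1[OF _ L conv]) (rule real_distribution_distr, simp)
  have intT: "integrable M (\<lambda>x. iexp (t * f x))" if [measurable]: "f \<in> borel_measurable M" for f
    by (rule integrable_iexp) (simp_all del: of_real_mult)
  have le: "ennreal (cmod (char (distr M borel (\<lambda>x. T n x + R n x)) t - char (distr M borel (T n)) t))
      \<le> ennreal \<bar>t\<bar> * (\<integral>\<^sup>+ x. ennreal \<bar>R n x\<bar> \<partial>M)" for n
  proof -
    have "char (distr M borel (\<lambda>x. T n x + R n x)) t - char (distr M borel (T n)) t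
        = (CLINT x|M. iexp (t * (T n x + R n x)) - iexp (t * T n x))"
      by (subst Bochner_Integration.integral_diff) (simp_all add: char_def integral_distr intT del: of_real_mult of_real_add)
    then have "ennreal (cmod (char (distr M borel (\<lambda>x. T n x + R n x)) t - char (distr M borel (T n)) t))
        \<le> (\<integral>\<^sup>+ x. ennreal (cmod (iexp (t * (T n x + R n x)) - iexp (t * T n x))) \<partial>M)"
      by (simp only:) (intro integral_norm_bound_ennreal Bochner_Integration.integrable_diff intT borel_measurable_add T R)
    also have "\<dots> \<le> (\<integral>\<^sup>+ x. ennreal \<bar>t\<bar> * ennreal \<bar>R n x\<bar> \<partial>M)"
    proof (rule nn_integral_mono)
      fix x
      have "iexp (t * (T n x + R n x)) - iexp (t * T n x) = iexp (t * T n x) * (iexp (t * R n x) - 1)"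
        by (simp add: algebra_simps exp_add[symmetric])
      then have "cmod (iexp (t * (T n x + R n x)) - iexp (t * T n x)) = cmod (iexp (t * R n x) - 1)"
        by (simp only: norm_mult norm_exp_i_times)
      also have "\<dots> \<le> \<bar>t\<bar> * \<bar>R n x\<bar>" using cmod_iexp_diff_1_le[of "t * R n x"] by (simp add: abs_mult)
      finally show "ennreal (cmod (iexp (t * (T n x + R n x)) - iexp (t * T n x))) \<le> ennreal \<bar>t\<bar> * ennreal \<bar>R n x\<bar>"
        by (simp add: ennreal_mult[symmetric])
    qed
    also have "\<dots> = ennreal \<bar>t\<bar> * (\<integral>\<^sup>+ x. ennreal \<bar>R n x\<bar> \<partial>M)" by (rule nn_integral_cmult) simp
    finally show ?thesis .
  qed
  have ub: "(\<lambda>n. ennreal \<bar>t\<bar> * (\<integral>\<^sup>+ x. ennreal \<bar>R n x\<bar> \<partial>M)) \<longlonglongrightarrow> 0"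
    using ennreal_tendsto_cmult[OF _ null, of "ennreal \<bar>t\<bar>"] by simp
  have "(\<lambda>n. ennreal (cmod (char (distr M borel (\<lambda>x. T n x + R n x)) t - char (distr M borel (T n)) t))) \<longlonglongrightarrow> ennreal 0"
    unfolding ennreal_0
    by (rule tendsto_sandwich[OF _ _ tendsto_const ub]) (simp_all only: le zero_le eventually_True)
  then have "(\<lambda>n. cmod (char (distr M borel (\<lambda>x. T n x + R n x)) t - char (distr M borel (T n)) t)) \<longlonglongrightarrow> 0"
    by (subst (asm) tendsto_ennreal_iff) (simp_all only: norm_ge_zero eventually_True order_refl)
  then have "(\<lambda>n. char (distr M borel (\<lambda>x. T n x + R n x)) t - char (distr M borel (T n)) t) \<longlonglongrightarrow> 0"
    by (simp only: tendsto_norm_zero_iff)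
  from tendsto_add[OF this lim]
  show "(\<lambda>n. char (distr M borel (\<lambda>x. T n x + R n x)) t) \<longlonglongrightarrow> char L t" by simp
qed

lemma normal_law_eq_distr:
  assumes "0 < v"
  shows "normal_law 0 v = distr std_normal_distribution borel (\<lambda>x. sqrt v * x)"
proof -
  interpret real_distribution std_normal_distribution by (rule real_dist_normal_dist)
  have "distributed std_normal_distribution lborel (\<lambda>x. x) std_normal_density"
    by (auto simp: distributed_def distr_id2)
  from normal_density_affine[OF this, of "sqrt v" 0] assms
  have "distr std_normal_distribution lborel (\<lambda>x. sqrt v * x) = density lborel (normal_density 0 (sqrt v))"
    by (simp add: distributed_def)
  then show ?thesis using assms by (simp add: normal_law_def cong: distr_cong)
qed

lemma real_distribution_normal_law: "0 \<le> v \<Longrightarrow> real_distribution (normal_law 0 v)"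
proof (cases "v = 0")
  case True
  then show ?thesis by (simp add: normal_law_def real_distribution_def real_distribution_axioms_def prob_space_return)
next
  case False
  moreover assume "0 \<le> v"
  ultimately show ?thesis
    by (simp add: normal_law_eq_distr)
      (intro prob_space.real_distribution_distr real_distribution.axioms(1)[OF real_dist_normal_dist], simp)
qed

text \<open>The variance may be degenerate, so two cases are needed. For \<open>v = 0\<close> every
  summand vanishes almost surely and all the laws equal the point mass at 0. For
  \<open>v > 0\<close> the standardised sum of the classical theorem is rescaled by
  \<open>sqrt v\<close> at the level of characteristic functions.\<close>

lemma (in prob_space) clt_normal_law:
  fixes Y :: "nat \<Rightarrow> 'a \<Rightarrow> real"
  assumes ind: "indep_vars (\<lambda>_. borel) Y UNIV"
    and mean: "\<And>i. expectation (Y i) = 0"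
    and sq: "\<And>i. integrable M (\<lambda>x. (Y i x)\<^sup>2)"
    and var: "\<And>i. expectation (\<lambda>x. (Y i x)\<^sup>2) = v"
    and law: "\<And>i. distr M borel (Y i) = L"
  shows "weak_conv_m (\<lambda>n. distr M borel (\<lambda>x. (\<Sum>i<n. Y i x) / sqrt (real n))) (normal_law 0 v)"
proof -
  have [measurable]: "Y i \<in> borel_measurable M" for i using ind by (auto simp: indep_vars_def)
  have v: "0 \<le> v" unfolding var[of 0, symmetric] by (rule Bochner_Integration.integral_nonneg) simp
  show ?thesis
  proof (cases "v = 0")
    case True
    have "AE x in M. Y i x = 0" for i
      using integral_nonneg_eq_0_iff_AE[OF sq[of i]] var[of i] True by simp
    then have ae: "AE x in M. \<forall>i. Y i x = 0" by (simp add: AE_all_countable)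
    have "distr M borel (\<lambda>x. (\<Sum>i<n. Y i x) / sqrt (real n)) = normal_law 0 v" for n
    proof -
      have "distr M borel (\<lambda>x. (\<Sum>i<n. Y i x) / sqrt (real n)) = distr M borel (\<lambda>x. 0)"
        by (rule distr_cong_AE) (use ae in auto)
      then show ?thesis using True by (simp add: normal_law_def)
    qed
    then show ?thesis by (simp add: weak_conv_m_def weak_conv_def)
  next
    case False
    with v have pos: "0 < v" by simp
    let ?Z = "\<lambda>n x. (\<Sum>i<n. Y i x) / sqrt (real n * (sqrt v)\<^sup>2)"
    have clt: "weak_conv_m (\<lambda>n. distr M borel (?Z n)) std_normal_distribution"
      by (rule central_limit_theorem_zero_mean[OF ind mean _ sq _ law])
        (use pos in \<open>auto simp: mean var\<close>)
    have Z: "(\<Sum>i<n. Y i x) / sqrt (real n) = sqrt v * ?Z n x" for n x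
      using pos by (simp add: real_sqrt_mult)
    show ?thesis
    proof (rule levy_continuity)
      show "real_distribution (distr M borel (\<lambda>x. (\<Sum>i<n. Y i x) / sqrt (real n)))" for n
        by (rule real_distribution_distr) simp
      show "real_distribution (normal_law 0 v)" by (rule real_distribution_normal_law[OF v])
      fix t
      have "(\<lambda>n. char (distr M borel (?Z n)) (t * sqrt v)) \<longlonglongrightarrow> char std_normal_distribution (t * sqrt v)"
        by (rule levy_continuity1[OF _ real_dist_normal_dist clt]) (rule real_distribution_distr, simp)
      also have "(\<lambda>n. char (distr M borel (?Z n)) (t * sqrt v)) = (\<lambda>n. char (distr M borel (\<lambda>x. (\<Sum>i<n. Y i x) / sqrt (real n))) t)"
        unfolding Z by (subst char_distr_scale) auto
      also have "char std_normal_distribution (t * sqrt v) = char (normal_law 0 v) t"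
        unfolding normal_law_eq_distr[OF pos]
        by (subst char_distr_scale) (auto simp: distr_id2)
      finally show "(\<lambda>n. char (distr M borel (\<lambda>x. (\<Sum>i<n. Y i x) / sqrt (real n))) t) \<longlonglongrightarrow> char (normal_law 0 v) t" .
    qed
  qed
qed

lemma weak_conv_m_compose:
  assumes "weak_conv_m M L" and f: "filterlim f at_top sequentially"
  shows "weak_conv_m (\<lambda>n. M (f n)) L"
  using assms(1) filterlim_compose[OF _ f, of "\<lambda>n. cdf (M n) _"]
  by (auto simp: weak_conv_m_def weak_conv_def)

text \<open>Cauchy-Schwarz against the constant 1 gives (E|R|)^2 <= E R^2. This turns a second
  moment bound into the L1 form that \<open>weak_conv_m_add_null\<close> takes.\<close>

lemma (in prob_space) nn_integral_abs_tendsto_0: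
  fixes R :: "nat \<Rightarrow> 'a \<Rightarrow> real"
  assumes [measurable]: "\<And>n. R n \<in> borel_measurable M"
    and lim: "(\<lambda>n. \<integral>\<^sup>+ x. ennreal ((R n x)\<^sup>2) \<partial>M) \<longlonglongrightarrow> 0"
  shows "(\<lambda>n. \<integral>\<^sup>+ x. ennreal \<bar>R n x\<bar> \<partial>M) \<longlonglongrightarrow> 0"
proof (rule tendsto_zero_ennreal)
  fix r :: real assume r: "0 < r"
  have "\<forall>\<^sub>F n in sequentially. (\<integral>\<^sup>+ x. ennreal ((R n x)\<^sup>2) \<partial>M) < ennreal (r\<^sup>2)"
    using r by (intro order_tendstoD(2)[OF lim]) simp
  then show "\<forall>\<^sub>F n in sequentially. (\<integral>\<^sup>+ x. ennreal \<bar>R n x\<bar> \<partial>M) < ennreal r"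
  proof eventually_elim
    case (elim n)
    have "(\<integral>\<^sup>+ x. ennreal \<bar>R n x\<bar> \<partial>M)\<^sup>2 \<le> (\<integral>\<^sup>+ x. ennreal ((R n x)\<^sup>2) \<partial>M)"
      using Cauchy_Schwarz_nn_integral[of "\<lambda>x. ennreal \<bar>R n x\<bar>" M "\<lambda>_. 1"]
      by (simp add: ennreal_power emeasure_space_1)
    with elim have less: "(\<integral>\<^sup>+ x. ennreal \<bar>R n x\<bar> \<partial>M)\<^sup>2 < ennreal (r\<^sup>2)" by simp
    show ?case
    proof (rule ccontr)
      assume "\<not> ?case"
      then have "ennreal r * ennreal r \<le> (\<integral>\<^sup>+ x. ennreal \<bar>R n x\<bar> \<partial>M) * (\<integral>\<^sup>+ x. ennreal \<bar>R n x\<bar> \<partial>M)"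
        by (intro mult_mono) (auto simp: not_less)
      with less r show False by (simp add: power2_eq_square ennreal_mult leD)
    qed
  qed
qed

subsection \<open>Cross-fitting over a random split\<close>

text \<open>For independent centred summands the cross terms drop out, and the normalisation leaves
  a single second moment. Centring is demanded only for square integrable \<open>g\<close>:
  otherwise the right side is infinite as soon as \<open>J\<close> is nonempty, and for empty
  \<open>J\<close> the left side is 0. A fitted function may fail to be square integrable for some
  training samples.\<close>

lemma (in prob_space) nn_second_moment_normalized_sum_le:
  fixes W :: "'i \<Rightarrow> 'a \<Rightarrow> 'o::topological_space" and g :: "'o \<Rightarrow> real"
  assumes J: "finite J" and ind: "indep_vars (\<lambda>_. borel) W J"
    and law: "\<And>i. i \<in> J \<Longrightarrow> distr M borel (W i) = P"
    and g [measurable]: "g \<in> borel_measurable borel"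
    and mean: "integrable P (\<lambda>v. (g v)\<^sup>2) \<Longrightarrow> (\<integral>v. g v \<partial>P) = 0"
  shows "(\<integral>\<^sup>+ x. ennreal (((\<Sum>i\<in>J. g (W i x)) / sqrt (card J))\<^sup>2) \<partial>M) \<le> (\<integral>\<^sup>+ v. ennreal ((g v)\<^sup>2) \<partial>P)"
proof (cases "J = {} \<or> \<not> integrable P (\<lambda>v. (g v)\<^sup>2)")
  case True
  then show ?thesis
  proof
    assume nint: "\<not> integrable P (\<lambda>v. (g v)\<^sup>2)"
    show ?thesis
    proof (cases "J = {}")
      case False
      then obtain i where "i \<in> J" by blast
      then have "sets P = sets borel" using law[of i] by (metis sets_distr)
      then have [measurable]: "g \<in> borel_measurable P" by (simp cong: measurable_cong_sets)
      have "\<not> (\<integral>\<^sup>+ v. ennreal ((g v)\<^sup>2) \<partial>P) < \<infinity>"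
        using nint by (simp add: integrable_iff_bounded)
      then show ?thesis by (simp only: not_less infinity_ennreal_def top_unique top_greatest)
    qed simp
  qed simp
next
  case False
  then have sq: "integrable P (\<lambda>v. (g v)\<^sup>2)" and ne: "J \<noteq> {}" by auto
  have [measurable]: "W i \<in> borel_measurable M" if "i \<in> J" for i
    using ind that by (auto simp: indep_vars_def)
  have ind': "indep_vars (\<lambda>_. borel) (\<lambda>i x. g (W i x)) J"
    by (rule indep_vars_compose2[OF ind]) simp
  have i: "integrable M (\<lambda>x. (g (W i x))\<^sup>2)" "expectation (\<lambda>x. g (W i x)) = 0"
    "expectation (\<lambda>x. (g (W i x))\<^sup>2) = (\<integral>v. (g v)\<^sup>2 \<partial>P)" if "i \<in> J" for i
    using that sq mean[OF sq] unfolding law[OF that, symmetric]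
    by (simp_all add: integrable_distr_eq integral_distr)
  note sm = second_moment_sum_indep[OF J ind' i(1,2)]
  have c: "0 < real (card J)" using J ne by (simp add: card_gt_0_iff)
  have "(\<integral>\<^sup>+ x. ennreal (((\<Sum>i\<in>J. g (W i x)) / sqrt (card J))\<^sup>2) \<partial>M)
      = (\<integral>\<^sup>+ x. ennreal ((\<Sum>i\<in>J. g (W i x))\<^sup>2 / card J) \<partial>M)"
    by (simp add: power_divide)
  also have "\<dots> = ennreal (expectation (\<lambda>x. (\<Sum>i\<in>J. g (W i x))\<^sup>2 / card J))"
    by (rule nn_integral_eq_integral) (use sm in auto)
  also have "\<dots> = ennreal (\<integral>v. (g v)\<^sup>2 \<partial>P)"
    using sm i(3) c by simp
  also have "\<dots> = (\<integral>\<^sup>+ v. ennreal ((g v)\<^sup>2) \<partial>P)"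
    by (rule nn_integral_eq_integral[symmetric, OF sq]) simp
  finally show ?thesis by simp
qed

text \<open>Disjoint blocks of an independent family are independent, so the training block can be
  frozen while the evaluation block is integrated. With frozen training data the fitted function is
  deterministic and the preceding bound applies.\<close>

lemma (in prob_space) nn_second_moment_fitted_sum_le:
  fixes W :: "nat \<Rightarrow> 'a \<Rightarrow> 'o::topological_space" and g :: "(nat \<Rightarrow> 'o) \<Rightarrow> 'o \<Rightarrow> real"
  assumes J: "finite J" "finite J'" "J \<inter> J' = {}" and ind: "indep_vars (\<lambda>_. borel) W UNIV"
    and law: "\<And>i. distr M borel (W i) = P"
    and g [measurable]: "(\<lambda>(w, v). g w v) \<in> borel_measurable (PiM J' (\<lambda>_. borel) \<Otimes>\<^sub>M borel)"
    and mean: "\<And>w. w \<in> space (PiM J' (\<lambda>_. borel)) \<Longrightarrow> integrable P (\<lambda>v. (g w v)\<^sup>2) \<Longrightarrow> (\<integral>v. g w v \<partial>P) = 0"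
  shows "(\<integral>\<^sup>+ x. ennreal (((\<Sum>i\<in>J. g (restrict (\<lambda>i. W i x) J') (W i x)) / sqrt (card J))\<^sup>2) \<partial>M)
      \<le> (\<integral>\<^sup>+ x. \<integral>\<^sup>+ v. ennreal ((g (restrict (\<lambda>i. W i x) J') v)\<^sup>2) \<partial>P \<partial>M)"
proof -
  let ?B = "\<lambda>J. PiM J (\<lambda>_. borel :: 'o measure)"
  have Wm [measurable]: "W i \<in> borel_measurable M" for i
    using ind by (auto simp: indep_vars_def)
  have iv: "indep_var (?B J') (\<lambda>x. restrict (\<lambda>i. W i x) J') (?B J) (\<lambda>x. restrict (\<lambda>i. W i x) J)"
    by (rule indep_var_restrict[OF ind]) (use J in auto)
  then have indep: "indep_set (sets (vimage_algebra (space M) (\<lambda>x. restrict (\<lambda>i. W i x) J') (?B J')))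
      (sets (vimage_algebra (space M) (\<lambda>x. restrict (\<lambda>i. W i x) J) (?B J)))"
    by (simp add: indep_var_eq sets_vimage_algebra)
  have [measurable]: "(\<lambda>p. g (fst p) (snd p i)) \<in> borel_measurable (?B J' \<Otimes>\<^sub>M ?B J)" if "i \<in> J" for i
    using measurable_compose[OF _ g, of "\<lambda>p. (fst p, snd p i)"] that by (simp add: case_prod_beta)
  have "(\<integral>\<^sup>+ x. ennreal (((\<Sum>i\<in>J. g (restrict (\<lambda>i. W i x) J') (W i x)) / sqrt (card J))\<^sup>2) \<partial>M)
     = (\<integral>\<^sup>+ x. \<integral>\<^sup>+ y. ennreal (((\<Sum>i\<in>J. g (restrict (\<lambda>i. W i x) J') (W i y)) / sqrt (card J))\<^sup>2) \<partial>M \<partial>M)"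
    using nn_integral_indep_set[OF indep_var_rv1[OF iv] indep_var_rv2[OF iv] indep, of "\<lambda>p. ennreal (((\<Sum>i\<in>J. g (fst p) (snd p i)) / sqrt (card J))\<^sup>2)"]
    by simp
  also have "\<dots> \<le> (\<integral>\<^sup>+ x. \<integral>\<^sup>+ v. ennreal ((g (restrict (\<lambda>i. W i x) J') v)\<^sup>2) \<partial>P \<partial>M)"
  proof (rule nn_integral_mono)
    fix x
    have sp: "restrict (\<lambda>i. W i x) J' \<in> space (?B J')" by (simp add: space_PiM)
    show "(\<integral>\<^sup>+ y. ennreal (((\<Sum>i\<in>J. g (restrict (\<lambda>i. W i x) J') (W i y)) / sqrt (card J))\<^sup>2) \<partial>M)
        \<le> (\<integral>\<^sup>+ v. ennreal ((g (restrict (\<lambda>i. W i x) J') v)\<^sup>2) \<partial>P)"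
      using measurable_Pair2[OF g sp]
      by (intro nn_second_moment_normalized_sum_le indep_vars_subset[OF ind] law mean sp J) auto
  qed
  finally show ?thesis .
qed

text \<open>Measurability is hidden in the independence clause of \<open>random_split\<close>:
  \<open>indep_set\<close> requires both families to consist of events, and the preimages of sets of
  splits form the first family.\<close>

lemma (in prob_space) random_split_measurable:
  fixes W :: "nat \<Rightarrow> 'a \<Rightarrow> 'o::topological_space"
  assumes split: "random_split M W I I' N N'"
  shows "(\<lambda>\<omega>. (I n \<omega>, I' n \<omega>)) \<in> measurable M (count_space (Collect finite \<times> Collect finite))"
proof (rule measurableI)
  let ?S = "count_space (Collect finite \<times> Collect finite) :: (nat set \<times> nat set) measure"
  let ?D = "\<lambda>\<omega>. (I n \<omega>, I' n \<omega>)"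
  have ind: "indep_set (sets (vimage_algebra (space M) ?D ?S))
      (sets (vimage_algebra (space M) (\<lambda>\<omega> i. W i \<omega>) (PiM UNIV (\<lambda>_. borel))))"
    using split by (simp add: random_split_def)
  show "?D \<omega> \<in> space ?S" if "\<omega> \<in> space M" for \<omega>
    using split that by (auto simp: random_split_def)
  fix A assume "A \<in> sets ?S"
  then have "?D -` A \<inter> space M \<in> sets (vimage_algebra (space M) ?D ?S)"
    by (auto simp: sets_vimage_algebra)
  then show "?D -` A \<inter> space M \<in> events" using indep_setD_ev1[OF ind] by blast
qed

text \<open>There are only countably many possible splits, so joint measurability may be checked split by split.\<close>

lemma measurable_finite_set_pairs:
  assumes "\<And>J J'. finite J \<Longrightarrow> finite J' \<Longrightarrow> f J J' \<in> measurable N K"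
  shows "(\<lambda>(d, w). f (fst d) (snd d) w)
    \<in> measurable (count_space (Collect finite \<times> Collect finite :: (nat set \<times> nat set) set) \<Otimes>\<^sub>M N) K"
  by (rule measurable_pair_measure_countable1)
    (use assms in \<open>auto simp: countable_SIGMA countable_Collect_finite\<close>)

lemma (in prob_space) random_split_measurable_compose:
  fixes W :: "nat \<Rightarrow> 'a \<Rightarrow> 'o::topological_space"
  assumes split: "random_split M W I I' N N'" and W: "\<And>i. W i \<in> borel_measurable M"
    and f: "\<And>J J'. finite J \<Longrightarrow> finite J' \<Longrightarrow> f J J' \<in> measurable (PiM UNIV (\<lambda>_. borel)) K"
  shows "(\<lambda>\<omega>. f (I n \<omega>) (I' n \<omega>) (\<lambda>i. W i \<omega>)) \<in> measurable M K"
proof -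
  have "(\<lambda>\<omega> i. W i \<omega>) \<in> measurable M (PiM UNIV (\<lambda>_. borel))"
    by (rule measurable_PiM_single') (use W in auto)
  from measurable_compose[OF measurable_Pair[OF random_split_measurable[OF split] this]
      measurable_finite_set_pairs[of f, OF f]]
  show ?thesis by simp
qed

text \<open>The split is independent of the whole data sequence, so it can be frozen while the data
  are redrawn.\<close>

lemma (in prob_space) nn_integral_random_split:
  fixes W :: "nat \<Rightarrow> 'a \<Rightarrow> 'o::topological_space"
  assumes split: "random_split M W I I' N N'" and W: "\<And>i. W i \<in> borel_measurable M"
    and f: "\<And>J J'. finite J \<Longrightarrow> finite J' \<Longrightarrow> f J J' \<in> borel_measurable (PiM UNIV (\<lambda>_. borel))"
  shows "(\<integral>\<^sup>+ \<omega>. f (I n \<omega>) (I' n \<omega>) (\<lambda>i. W i \<omega>) \<partial>M)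
    = (\<integral>\<^sup>+ \<omega>. \<integral>\<^sup>+ \<omega>'. f (I n \<omega>) (I' n \<omega>) (\<lambda>i. W i \<omega>') \<partial>M \<partial>M)"
proof -
  have Wm: "(\<lambda>\<omega> i. W i \<omega>) \<in> measurable M (PiM UNIV (\<lambda>_. borel))"
    by (rule measurable_PiM_single') (use W in auto)
  show ?thesis
    using nn_integral_indep_set[OF random_split_measurable[OF split] Wm _ measurable_finite_set_pairs[of f, OF f]] split
    by (simp add: random_split_def)
qed

text \<open>Two successive freezings: first the split, which leaves fixed disjoint index sets, and
  then the training data, inside \<open>nn_second_moment_fitted_sum_le\<close>.\<close>

lemma (in prob_space) nn_second_moment_cross_fit_le:
  fixes W :: "nat \<Rightarrow> 'a \<Rightarrow> 'o::topological_space" and g :: "nat set \<Rightarrow> (nat \<Rightarrow> 'o) \<Rightarrow> 'o \<Rightarrow> real"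
  assumes split: "random_split M W I I' N N'"
    and ind: "indep_vars (\<lambda>_. borel) W UNIV"
    and law: "\<And>i. distr M borel (W i) = P"
    and g: "\<And>J. finite J \<Longrightarrow> (\<lambda>(w, v). g J w v) \<in> borel_measurable (PiM J (\<lambda>_. borel) \<Otimes>\<^sub>M borel)"
    and mean: "\<And>J w. finite J \<Longrightarrow> w \<in> space (PiM J (\<lambda>_. borel)) \<Longrightarrow>
        integrable P (\<lambda>v. (g J w v)\<^sup>2) \<Longrightarrow> (\<integral>v. g J w v \<partial>P) = 0"
  defines "R \<equiv> \<lambda>n \<omega>. (\<Sum>i\<in>I n \<omega>. g (I' n \<omega>) (restrict (\<lambda>i. W i \<omega>) (I' n \<omega>)) (W i \<omega>)) / sqrt (card (I n \<omega>))"
  shows "R n \<in> borel_measurable M"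
    and "(\<integral>\<^sup>+ \<omega>. ennreal ((R n \<omega>)\<^sup>2) \<partial>M)
      \<le> (\<integral>\<^sup>+ \<omega>. \<integral>\<^sup>+ v. ennreal ((g (I' n \<omega>) (restrict (\<lambda>i. W i \<omega>) (I' n \<omega>)) v)\<^sup>2) \<partial>P \<partial>M)"
proof -
  have W: "W i \<in> borel_measurable M" for i using ind by (auto simp: indep_vars_def)
  interpret P: prob_space P using prob_space_distr[OF W, of 0] by (simp add: law)
  have P [measurable_cong]: "sets P = sets borel" unfolding law[of 0, symmetric] by simp
  let ?r = "\<lambda>J J' w. (\<Sum>i\<in>J. g J' (restrict w J') (w i)) / sqrt (card J)"
  let ?b = "\<lambda>J J' w. \<integral>\<^sup>+ v. ennreal ((g J' (restrict w J') v)\<^sup>2) \<partial>P"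
  have [measurable]: "(\<lambda>w. g J' (restrict w J') (w i)) \<in> borel_measurable (PiM UNIV (\<lambda>_. borel))"
    if "finite J'" for J' and i :: nat
    using measurable_compose[OF _ g[OF that], of "\<lambda>w. (restrict w J', w i)"]
    by (simp add: measurable_restrict_subset)
  have rm: "?r J J' \<in> borel_measurable (PiM UNIV (\<lambda>_. borel))" if "finite J'" for J J'
    using that by measurable
  then have rm2: "(\<lambda>w. ennreal ((?r J J' w)\<^sup>2)) \<in> borel_measurable (PiM UNIV (\<lambda>_. borel))" if "finite J'" for J J'
    using that by measurable
  have bm: "?b J J' \<in> borel_measurable (PiM UNIV (\<lambda>_. borel))" if "finite J'" for J J' :: "nat set"
  proof -
    note [measurable] = g[OF that]
    have "(\<lambda>(w, v). g J' w v) \<in> borel_measurable (PiM J' (\<lambda>_. borel) \<Otimes>\<^sub>M P)"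
      by measurable
    then have "(\<lambda>w. \<integral>\<^sup>+ v. ennreal ((g J' w v)\<^sup>2) \<partial>P) \<in> borel_measurable (PiM J' (\<lambda>_. borel))"
      by (intro P.borel_measurable_nn_integral) (simp add: case_prod_beta)
    then show ?thesis
      by (rule measurable_compose[rotated]) (simp add: measurable_restrict_subset)
  qed
  show "R n \<in> borel_measurable M"
    unfolding R_def using rm by (intro random_split_measurable_compose[OF split W, where f = ?r]) auto
  have "(\<integral>\<^sup>+ \<omega>. ennreal ((R n \<omega>)\<^sup>2) \<partial>M)
      = (\<integral>\<^sup>+ \<omega>. \<integral>\<^sup>+ \<omega>'. ennreal ((?r (I n \<omega>) (I' n \<omega>) (\<lambda>i. W i \<omega>'))\<^sup>2) \<partial>M \<partial>M)"
    unfolding R_def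
    by (rule nn_integral_random_split[OF split W, where f = "\<lambda>J J' w. ennreal ((?r J J' w)\<^sup>2)"])
      (use rm2 in auto)
  also have "\<dots> \<le> (\<integral>\<^sup>+ \<omega>. \<integral>\<^sup>+ \<omega>'. ?b (I n \<omega>) (I' n \<omega>) (\<lambda>i. W i \<omega>') \<partial>M \<partial>M)"
  proof (rule nn_integral_mono)
    fix \<omega> assume "\<omega> \<in> space M"
    then have "finite (I n \<omega>)" "finite (I' n \<omega>)" "I n \<omega> \<inter> I' n \<omega> = {}"
      using split by (auto simp: random_split_def)
    then show "(\<integral>\<^sup>+ \<omega>'. ennreal ((?r (I n \<omega>) (I' n \<omega>) (\<lambda>i. W i \<omega>'))\<^sup>2) \<partial>M)
        \<le> (\<integral>\<^sup>+ \<omega>'. ?b (I n \<omega>) (I' n \<omega>) (\<lambda>i. W i \<omega>') \<partial>M)"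
      by (intro nn_second_moment_fitted_sum_le ind law g mean)
  qed
  \<comment> \<open>The bound still mixes the split at \<open>\<omega>\<close> with data at
    \<open>\<omega>'\<close>. The freezing identity, read backwards, puts both at the same sample
    point.\<close>
  also have "\<dots> = (\<integral>\<^sup>+ \<omega>. ?b (I n \<omega>) (I' n \<omega>) (\<lambda>i. W i \<omega>) \<partial>M)"
    by (rule nn_integral_random_split[OF split W, where f = ?b, symmetric])
      (use bm in auto)
  finally show "(\<integral>\<^sup>+ \<omega>. ennreal ((R n \<omega>)\<^sup>2) \<partial>M)
      \<le> (\<integral>\<^sup>+ \<omega>. \<integral>\<^sup>+ v. ennreal ((g (I' n \<omega>) (restrict (\<lambda>i. W i \<omega>) (I' n \<omega>)) v)\<^sup>2) \<partial>P \<partial>M)" .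
qed

text \<open>By independence the characteristic function of the sum is that of \<open>h\<close> under
  \<open>P\<close> raised to the number of indices, and characteristic functions determine
  laws.\<close>

lemma (in prob_space) distr_sum_iid_eq:
  fixes W :: "nat \<Rightarrow> 'a \<Rightarrow> 'o::topological_space" and h :: "'o \<Rightarrow> real"
  assumes ind: "indep_vars (\<lambda>_. borel) W UNIV"
    and law: "\<And>i. distr M borel (W i) = P"
    and h [measurable]: "h \<in> borel_measurable borel"
    and card: "card J = card K"
  shows "distr M borel (\<lambda>x. \<Sum>i\<in>J. h (W i x)) = distr M borel (\<lambda>x. \<Sum>i\<in>K. h (W i x))"
proof -
  have [measurable]: "W i \<in> borel_measurable M" for i using ind by (auto simp: indep_vars_def)
  have indh: "indep_vars (\<lambda>_. borel) (\<lambda>i x. h (W i x)) L" for L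
    by (rule indep_vars_compose2[OF indep_vars_subset[OF ind]]) auto
  have "distr M borel (\<lambda>x. h (W i x)) = distr P borel h" for i
    unfolding law[of i, symmetric] by (simp add: distr_distr comp_def)
  then have "char (distr M borel (\<lambda>x. \<Sum>i\<in>L. h (W i x))) t = char (distr P borel h) t ^ card L" for L t
    by (simp add: char_distr_sum[OF indh])
  then show ?thesis
    by (intro Levy_uniqueness real_distribution_distr ext) (simp_all add: card)
qed

text \<open>For a frozen split the law of the normalised sum depends only on the cardinality, which
  is the deterministic number \<open>N n\<close>, so averaging over splits averages a constant. The
  random evaluation set can thus be exchanged for an initial segment, to which the classical limit
  theorem applies.\<close>

lemma (in prob_space) distr_random_split_sum:
  fixes W :: "nat \<Rightarrow> 'a \<Rightarrow> 'o::topological_space" and h :: "'o \<Rightarrow> real"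
  assumes split: "random_split M W I I' N N'"
    and ind: "indep_vars (\<lambda>_. borel) W UNIV"
    and law: "\<And>i. distr M borel (W i) = P"
    and h [measurable]: "h \<in> borel_measurable borel"
  defines "T \<equiv> \<lambda>n \<omega>. (\<Sum>i\<in>I n \<omega>. h (W i \<omega>)) / sqrt (card (I n \<omega>))"
  shows "T n \<in> borel_measurable M"
    and "distr M borel (T n) = distr M borel (\<lambda>\<omega>. (\<Sum>i<N n. h (W i \<omega>)) / sqrt (N n))"
proof -
  have W [measurable]: "W i \<in> borel_measurable M" for i using ind by (auto simp: indep_vars_def)
  \<comment> \<open>\<open>J'\<close> is a dummy argument that gives \<open>?t\<close> the shape
    expected by the lemmas on random splits.\<close>
  let ?t = "\<lambda>J J' w. (\<Sum>i\<in>J. h (w i)) / sqrt (card J)"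
  have tm: "?t J J' \<in> borel_measurable (PiM UNIV (\<lambda>_. borel))" for J J' :: "nat set"
    by measurable
  show T: "T n \<in> borel_measurable M"
    unfolding T_def by (rule random_split_measurable_compose[OF split W, where f = ?t]) (use tm in auto)
  show "distr M borel (T n) = distr M borel (\<lambda>\<omega>. (\<Sum>i<N n. h (W i \<omega>)) / sqrt (N n))"
  proof (rule measure_eqI)
    fix B assume "B \<in> sets (distr M borel (T n))"
    then have B [measurable]: "B \<in> sets borel" by simp
    have fixed: "(\<integral>\<^sup>+ \<omega>'. indicator B (?t J J' (\<lambda>i. W i \<omega>')) \<partial>M)
        = emeasure (distr M borel (\<lambda>\<omega>. (\<Sum>i<N n. h (W i \<omega>)) / sqrt (N n))) B"
      if "card J = N n" for J J' :: "nat set"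
    proof -
      have "distr M borel (\<lambda>\<omega>. (\<Sum>i\<in>J. h (W i \<omega>)) / sqrt (N n)) = distr (distr M borel (\<lambda>\<omega>. \<Sum>i\<in>J. h (W i \<omega>))) borel (\<lambda>s. s / sqrt (N n))"
        by (simp add: distr_distr comp_def)
      also have "\<dots> = distr (distr M borel (\<lambda>\<omega>. \<Sum>i<N n. h (W i \<omega>))) borel (\<lambda>s. s / sqrt (N n))"
        using that by (subst distr_sum_iid_eq[OF ind law h, of J "{..<N n}"]) auto
      also have "\<dots> = distr M borel (\<lambda>\<omega>. (\<Sum>i<N n. h (W i \<omega>)) / sqrt (N n))"
        by (simp add: distr_distr comp_def)
      finally have eq: "distr M borel (\<lambda>\<omega>. (\<Sum>i\<in>J. h (W i \<omega>)) / sqrt (N n))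
          = distr M borel (\<lambda>\<omega>. (\<Sum>i<N n. h (W i \<omega>)) / sqrt (N n))" .
      show ?thesis
        unfolding eq[symmetric]
        by (simp add: that nn_integral_indicator[symmetric] nn_integral_distr del: nn_integral_indicator)
    qed
    have "emeasure (distr M borel (T n)) B = (\<integral>\<^sup>+ \<omega>. indicator B (T n \<omega>) \<partial>M)"
      using T by (simp add: nn_integral_indicator[symmetric] nn_integral_distr del: nn_integral_indicator)
    also have "\<dots> = (\<integral>\<^sup>+ \<omega>. \<integral>\<^sup>+ \<omega>'. indicator B (?t (I n \<omega>) (I' n \<omega>) (\<lambda>i. W i \<omega>')) \<partial>M \<partial>M)"
      unfolding T_def
      by (rule nn_integral_random_split[OF split W, where f = "\<lambda>J J' w. indicator B (?t J J' w)"])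
        (use tm in auto)
    also have "\<dots> = (\<integral>\<^sup>+ \<omega>. emeasure (distr M borel (\<lambda>\<omega>. (\<Sum>i<N n. h (W i \<omega>)) / sqrt (N n))) B \<partial>M)"
    proof (rule nn_integral_cong, rule fixed)
      fix \<omega> assume "\<omega> \<in> space M"
      then show "card (I n \<omega>) = N n" using split by (simp add: random_split_def)
    qed
    also have "\<dots> = emeasure (distr M borel (\<lambda>\<omega>. (\<Sum>i<N n. h (W i \<omega>)) / sqrt (N n))) B"
      by (simp add: emeasure_space_1)
    finally show "emeasure (distr M borel (T n)) B = emeasure (distr M borel (\<lambda>\<omega>. (\<Sum>i<N n. h (W i \<omega>)) / sqrt (N n))) B" .
  qed simp
qed

subsection \<open>Inverse probability weighting\<close>

text \<open>Inverse probability weighting as a change of measure. On a rectangle, conditional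
  independence factors the conditional probability given \<open>V\<close>, and the weight
  \<open>1 / p\<close> cancels the factor for \<open>Z = 1\<close>; a pi-system argument extends
  this. Equality of laws transfers integrability together with the integrals.\<close>

lemma ipw_distr_eq:
  fixes Y :: "'w \<Rightarrow> 'b::topological_space" and V :: "'w \<Rightarrow> 'd::topological_space" and Z :: "'w \<Rightarrow> real"
  assumes "prob_space Q"
    and [measurable]: "Y \<in> borel_measurable Q" "V \<in> borel_measurable Q" "Z \<in> borel_measurable Q"
    and ci: "cond_indep_given Q Y Z V"
    and p: "is_cond_exp_fun Q (indicat_real (Z -` {1})) V p"
    and \<eta>: "0 < \<eta>" "\<And>v. \<eta> \<le> p v"
  shows "distr (density Q (\<lambda>\<omega>. ennreal (indicat_real {1} (Z \<omega>) / p (V \<omega>)))) (borel \<Otimes>\<^sub>M borel) (\<lambda>\<omega>. (V \<omega>, Y \<omega>))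
       = distr Q (borel \<Otimes>\<^sub>M borel) (\<lambda>\<omega>. (V \<omega>, Y \<omega>))" (is "?L = ?R")
proof -
  interpret Q: prob_space Q by fact
  let ?F = "vimage_algebra (space Q) V borel"
  let ?E = "{a \<times> b |a b. a \<in> sets (borel :: 'd measure) \<and> b \<in> sets (borel :: 'b measure)}"
  interpret finite_measure_subalgebra Q ?F
  proof
    show "subalgebra Q ?F"
      unfolding subalgebra_def
      by (auto simp: sets_vimage_algebra2 intro: measurable_sets[OF \<open>V \<in> borel_measurable Q\<close>])
  qed
  have [measurable]: "p \<in> borel_measurable borel"
    and pF: "AE \<omega> in Q. real_cond_exp Q ?F (indicat_real (Z -` {1})) \<omega> = p (V \<omega>)"
    using p by (auto simp: is_cond_exp_fun_def)
  have [measurable]: "V \<in> borel_measurable ?F" by (rule measurable_vimage_algebra1) simp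
  have ppos: "0 < p v" for v using \<eta>(1) \<eta>(2)[of v] by linarith
  have eq: "emeasure ?L (a \<times> b) = emeasure ?R (a \<times> b)"
    if [measurable]: "a \<in> sets borel" "b \<in> sets borel" for a b
  proof -
    let ?h = "\<lambda>\<omega>. indicat_real a (V \<omega>) / p (V \<omega>)"
    let ?h' = "\<lambda>\<omega>. indicat_real a (V \<omega>)"
    let ?g = "indicat_real (Y -` b \<inter> Z -` {1})"
    let ?gb = "indicat_real (Y -` b)"
    have g_eq: "?g = (\<lambda>\<omega>. indicat_real b (Y \<omega>) * indicat_real {1} (Z \<omega>))"
      "?gb = (\<lambda>\<omega>. indicat_real b (Y \<omega>))"
      by (auto simp: indicator_def)
    have [measurable]: "?g \<in> borel_measurable Q" "?gb \<in> borel_measurable Q"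
      unfolding g_eq by measurable
    \<comment> \<open>The lower bound on \<open>p\<close> keeps the weight below
      \<open>1 / \<eta>\<close>, so both products are bounded and factors measurable with respect to
      \<open>V\<close> can be pulled out of conditional expectations.\<close>
    have int: "integrable Q (\<lambda>\<omega>. ?h \<omega> * ?g \<omega>)" "integrable Q (\<lambda>\<omega>. ?h' \<omega> * ?gb \<omega>)"
    proof -
      have "\<bar>?h \<omega> * ?g \<omega>\<bar> \<le> 1 / \<eta>" for \<omega>
        using \<eta>(1) \<eta>(2)[of "V \<omega>"] ppos[of "V \<omega>"] by (auto simp: indicator_def frac_le)
      then show "integrable Q (\<lambda>\<omega>. ?h \<omega> * ?g \<omega>)"
        by (intro Q.integrable_const_bound[of _ "1 / \<eta>"]) auto
      show "integrable Q (\<lambda>\<omega>. ?h' \<omega> * ?gb \<omega>)"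
        by (intro Q.integrable_const_bound[of _ 1]) (auto simp: indicator_def)
    qed
    have ae: "AE \<omega> in Q. real_cond_exp Q ?F ?g \<omega> = real_cond_exp Q ?F ?gb \<omega> * p (V \<omega>)"
    proof -
      have "AE \<omega> in Q. real_cond_exp Q ?F ?g \<omega> =
          real_cond_exp Q ?F ?gb \<omega> * real_cond_exp Q ?F (indicat_real (Z -` {1})) \<omega>"
        using ci that(2) by (simp add: cond_indep_given_def)
      with pF show ?thesis by eventually_elim simp
    qed
    \<comment> \<open>Pass to the conditional expectation given \<open>V\<close>, cancel
      \<open>p\<close>, and pass back.\<close>
    have "(\<integral>\<omega>. ?h \<omega> * ?g \<omega> \<partial>Q) = (\<integral>\<omega>. ?h \<omega> * real_cond_exp Q ?F ?g \<omega> \<partial>Q)"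
      by (rule real_cond_exp_intg(2)[symmetric]) (use int in auto)
    also have "\<dots> = (\<integral>\<omega>. ?h' \<omega> * real_cond_exp Q ?F ?gb \<omega> \<partial>Q)"
    proof (rule integral_cong_AE)
      show "AE \<omega> in Q. ?h \<omega> * real_cond_exp Q ?F ?g \<omega> = ?h' \<omega> * real_cond_exp Q ?F ?gb \<omega>"
        using ae by eventually_elim (use ppos in \<open>simp add: less_imp_neq[OF ppos, symmetric]\<close>)
    qed auto
    also have "\<dots> = (\<integral>\<omega>. ?h' \<omega> * ?gb \<omega> \<partial>Q)"
      by (rule real_cond_exp_intg(2)) (use int in auto)
    finally have main: "(\<integral>\<omega>. ?h \<omega> * ?g \<omega> \<partial>Q) = (\<integral>\<omega>. ?h' \<omega> * ?gb \<omega> \<partial>Q)" .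
    have "emeasure ?L (a \<times> b) = (\<integral>\<^sup>+ \<omega>. indicator (a \<times> b) (V \<omega>, Y \<omega>) \<partial>density Q (\<lambda>\<omega>. ennreal (indicat_real {1} (Z \<omega>) / p (V \<omega>))))"
      by (simp add: nn_integral_indicator[symmetric] nn_integral_distr del: nn_integral_indicator)
    also have "\<dots> = (\<integral>\<^sup>+ \<omega>. ennreal (?h \<omega> * ?g \<omega>) \<partial>Q)"
      by (subst nn_integral_density) (auto intro!: nn_integral_cong simp: indicator_def)
    also have "\<dots> = ennreal (\<integral>\<omega>. ?h \<omega> * ?g \<omega> \<partial>Q)"
      by (rule nn_integral_eq_integral[OF int(1)]) (auto simp: indicator_def less_imp_le[OF ppos])
    also have "\<dots> = ennreal (\<integral>\<omega>. ?h' \<omega> * ?gb \<omega> \<partial>Q)" by (simp only: main)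
    also have "\<dots> = (\<integral>\<^sup>+ \<omega>. ennreal (?h' \<omega> * ?gb \<omega>) \<partial>Q)"
      by (rule nn_integral_eq_integral[OF int(2), symmetric]) (auto simp: indicator_def)
    also have "\<dots> = (\<integral>\<^sup>+ \<omega>. indicator (a \<times> b) (V \<omega>, Y \<omega>) \<partial>Q)"
      by (auto intro!: nn_integral_cong simp: indicator_def)
    also have "\<dots> = emeasure ?R (a \<times> b)"
      by (simp add: nn_integral_indicator[symmetric] nn_integral_distr del: nn_integral_indicator)
    finally show ?thesis .
  qed
  interpret R: prob_space ?R by (rule Q.prob_space_distr) simp
  show ?thesis
  proof (rule measure_eqI_generator_eq[OF Int_stable_pair_measure_generator[of borel borel], where A="\<lambda>_. UNIV" and \<Omega>=UNIV])
    show "range (\<lambda>_. UNIV) \<subseteq> ?E" by (auto intro!: exI[of _ UNIV])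
    \<comment> \<open>\<open>UNIV\<close> is itself a rectangle, so its mass under \<open>?L\<close>
      is that under the probability measure \<open>?R\<close>. Finiteness allows the constant
      cover.\<close>
    show "emeasure ?L UNIV \<noteq> \<infinity>" using eq[of UNIV UNIV] R.emeasure_finite[of UNIV] by simp
    fix X assume "X \<in> ?E"
    then show "emeasure ?L X = emeasure ?R X" using eq by auto
  qed (auto simp: sets_pair_measure)
qed

text \<open>Since \<open>Z\<close> is almost surely 0 or 1, \<open>Z / p\<close> is the density of
  \<open>ipw_distr_eq\<close>, and both claims are a change of variables. The integral identity
  carries no integrability premise: by the first claim both integrands are integrable, or both
  integrals take the default value 0.\<close>

lemma ipw_expectation:
  fixes Y :: "'w \<Rightarrow> 'b::topological_space" and V :: "'w \<Rightarrow> 'd::topological_space" and Z :: "'w \<Rightarrow> real"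
    and k :: "'d \<times> 'b \<Rightarrow> real"
  assumes Q: "prob_space Q"
    and meas [measurable]: "Y \<in> borel_measurable Q" "V \<in> borel_measurable Q" "Z \<in> borel_measurable Q"
    and ci: "cond_indep_given Q Y Z V"
    and p: "is_cond_exp_fun Q (indicat_real (Z -` {1})) V p"
    and \<eta>: "0 < \<eta>" "\<And>v. \<eta> \<le> p v"
    and Z: "AE \<omega> in Q. Z \<omega> \<in> {0, 1}"
    and k [measurable]: "k \<in> borel_measurable (borel \<Otimes>\<^sub>M borel)"
  shows "integrable Q (\<lambda>\<omega>. Z \<omega> / p (V \<omega>) * k (V \<omega>, Y \<omega>)) \<longleftrightarrow> integrable Q (\<lambda>\<omega>. k (V \<omega>, Y \<omega>))"
    and "(\<integral>\<omega>. Z \<omega> / p (V \<omega>) * k (V \<omega>, Y \<omega>) \<partial>Q) = (\<integral>\<omega>. k (V \<omega>, Y \<omega>) \<partial>Q)"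
proof -
  have [measurable]: "p \<in> borel_measurable borel" using p by (simp add: is_cond_exp_fun_def)
  let ?z = "\<lambda>\<omega>. indicat_real {1} (Z \<omega>) / p (V \<omega>)"
  let ?L = "distr (density Q (\<lambda>\<omega>. ennreal (?z \<omega>))) (borel \<Otimes>\<^sub>M borel) (\<lambda>\<omega>. (V \<omega>, Y \<omega>))"
  let ?R = "distr Q (borel \<Otimes>\<^sub>M borel) (\<lambda>\<omega>. (V \<omega>, Y \<omega>))"
  note eq = ipw_distr_eq[OF Q meas ci p \<eta>]
  have z: "0 \<le> ?z \<omega>" for \<omega> using \<eta>(1) \<eta>(2)[of "V \<omega>"] by simp
  have ae: "AE \<omega> in Q. Z \<omega> / p (V \<omega>) * k (V \<omega>, Y \<omega>) = ?z \<omega> *\<^sub>R k (V \<omega>, Y \<omega>)"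
    using Z by eventually_elim auto
  have "integrable Q (\<lambda>\<omega>. Z \<omega> / p (V \<omega>) * k (V \<omega>, Y \<omega>)) \<longleftrightarrow> integrable Q (\<lambda>\<omega>. ?z \<omega> *\<^sub>R k (V \<omega>, Y \<omega>))"
    by (rule integrable_cong_AE) (use ae in auto)
  also have "\<dots> \<longleftrightarrow> integrable ?L k"
    by (subst integrable_distr_eq; (subst integrable_density)?) (use z in auto)
  also have "\<dots> \<longleftrightarrow> integrable Q (\<lambda>\<omega>. k (V \<omega>, Y \<omega>))"
    unfolding eq by (subst integrable_distr_eq) auto
  finally show "integrable Q (\<lambda>\<omega>. Z \<omega> / p (V \<omega>) * k (V \<omega>, Y \<omega>)) \<longleftrightarrow> integrable Q (\<lambda>\<omega>. k (V \<omega>, Y \<omega>))" .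
  have "(\<integral>\<omega>. Z \<omega> / p (V \<omega>) * k (V \<omega>, Y \<omega>) \<partial>Q) = (\<integral>\<omega>. ?z \<omega> *\<^sub>R k (V \<omega>, Y \<omega>) \<partial>Q)"
    by (rule integral_cong_AE) (use ae in auto)
  also have "\<dots> = integral\<^sup>L ?L k"
    by (subst integral_distr; (subst integral_density)?) (use z in auto)
  also have "\<dots> = (\<integral>\<omega>. k (V \<omega>, Y \<omega>) \<partial>Q)"
    unfolding eq by (subst integral_distr) auto
  finally show "(\<integral>\<omega>. Z \<omega> / p (V \<omega>) * k (V \<omega>, Y \<omega>) \<partial>Q) = (\<integral>\<omega>. k (V \<omega>, Y \<omega>) \<partial>Q)" .
qed

text \<open>\<open>k\<close> itself need not be integrable, since the weight \<open>1 - Z / p\<close> may vanish; hence the truncation.\<close>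

lemma ipw_residual_expectation:
  fixes Y :: "'w \<Rightarrow> 'b::topological_space" and V :: "'w \<Rightarrow> 'd::topological_space" and Z :: "'w \<Rightarrow> real"
    and k :: "'d \<times> 'b \<Rightarrow> real"
  assumes Q: "prob_space Q"
    and meas [measurable]: "Y \<in> borel_measurable Q" "V \<in> borel_measurable Q" "Z \<in> borel_measurable Q"
    and ci: "cond_indep_given Q Y Z V"
    and p: "is_cond_exp_fun Q (indicat_real (Z -` {1})) V p"
    and \<eta>: "0 < \<eta>" "\<And>v. \<eta> \<le> p v"
    and Z: "AE \<omega> in Q. Z \<omega> \<in> {0, 1}"
    and k [measurable]: "k \<in> borel_measurable (borel \<Otimes>\<^sub>M borel)"
    and int: "integrable Q (\<lambda>\<omega>. (1 - Z \<omega> / p (V \<omega>)) * k (V \<omega>, Y \<omega>))"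
  shows "(\<integral>\<omega>. (1 - Z \<omega> / p (V \<omega>)) * k (V \<omega>, Y \<omega>) \<partial>Q) = 0"
proof -
  interpret Q: prob_space Q by fact
  have [measurable]: "p \<in> borel_measurable borel" using p by (simp add: is_cond_exp_fun_def)
  let ?k = "\<lambda>n v. if \<bar>k v\<bar> \<le> real n then k v else 0"
  let ?s = "\<lambda>n \<omega>. (1 - Z \<omega> / p (V \<omega>)) * ?k n (V \<omega>, Y \<omega>)"
  \<comment> \<open>A truncated function is bounded, so the difference can be split into two
    integrable parts with equal integrals.\<close>
  have zero: "(\<integral>\<omega>. ?s n \<omega> \<partial>Q) = 0" for n
  proof -
    have km: "?k n \<in> borel_measurable (borel \<Otimes>\<^sub>M borel)" by measurable
    note ipw = ipw_expectation[OF Q meas ci p \<eta> Z km]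
    have i: "integrable Q (\<lambda>\<omega>. ?k n (V \<omega>, Y \<omega>))"
      by (rule Q.integrable_const_bound[of _ "real n"]) auto
    have "(\<integral>\<omega>. ?s n \<omega> \<partial>Q) = (\<integral>\<omega>. ?k n (V \<omega>, Y \<omega>) - Z \<omega> / p (V \<omega>) * ?k n (V \<omega>, Y \<omega>) \<partial>Q)"
      by (simp add: left_diff_distrib)
    also have "\<dots> = 0"
      using i ipw by (subst Bochner_Integration.integral_diff) auto
    finally show ?thesis .
  qed
  have "(\<lambda>n. \<integral>\<omega>. ?s n \<omega> \<partial>Q) \<longlonglongrightarrow> (\<integral>\<omega>. (1 - Z \<omega> / p (V \<omega>)) * k (V \<omega>, Y \<omega>) \<partial>Q)"
  \<comment> \<open>Truncation only shrinks the integrand in absolute value, so the limit function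
    itself, integrable by \<open>int\<close>, serves as dominating function.\<close>
  proof (rule integral_dominated_convergence[OF _ _ integrable_norm[OF int]])
    show "AE \<omega> in Q. (\<lambda>n. ?s n \<omega>) \<longlonglongrightarrow> (1 - Z \<omega> / p (V \<omega>)) * k (V \<omega>, Y \<omega>)"
    proof (rule AE_I2, rule tendsto_eventually)
      fix \<omega>
      obtain m where "\<bar>k (V \<omega>, Y \<omega>)\<bar> \<le> real m" using real_arch_simple by blast
      then show "\<forall>\<^sub>F n in sequentially. ?s n \<omega> = (1 - Z \<omega> / p (V \<omega>)) * k (V \<omega>, Y \<omega>)"
        unfolding eventually_sequentially by (intro exI[of _ m]) auto
    qed
  qed (auto simp: abs_mult)
  then show ?thesis by (simp add: zero LIMSEQ_const_iff)
qed

section \<open>The AIPW score as an affine function of the regression function\<close>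

definition ipw_residual :: "(real ^ 'k \<Rightarrow> real) \<Rightarrow> (('k, 'l) features \<Rightarrow> real) \<Rightarrow> ('k, 'l) obs \<Rightarrow> real" where
  "ipw_residual \<pi> f = (\<lambda>(m, a, x, u). (1 - a / \<pi> x) * f (x, u))"

lemma aipw_score_diff: "aipw_score \<pi> f w - aipw_score \<pi> g w = ipw_residual \<pi> (\<lambda>v. f v - g v) w"
  by (cases w) (simp add: aipw_score_def ipw_residual_def diff_divide_distrib algebra_simps)

text \<open>The regression function plugged in later depends on the training sample, so
  measurability is required jointly in the training data \<open>w\<close> and the observation
  \<open>v\<close>.\<close>

lemma ipw_residual_measurable:
  assumes [measurable]: "\<pi> \<in> borel_measurable borel"
    and f [measurable]: "(\<lambda>(w, v). f w v) \<in> borel_measurable (N \<Otimes>\<^sub>M borel)"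
  shows "(\<lambda>(w, v). ipw_residual \<pi> (f w) v) \<in> borel_measurable (N \<Otimes>\<^sub>M borel)"
proof -
  have [measurable]: "(\<lambda>(w, x, u). f w (x, u)) \<in> borel_measurable (N \<Otimes>\<^sub>M borel \<Otimes>\<^sub>M borel)"
    using f unfolding borel_prod[symmetric] by (simp add: case_prod_beta)
  show ?thesis
    unfolding ipw_residual_def borel_prod[symmetric] by measurable
qed

lemma aipw_score_measurable:
  assumes [measurable]: "\<pi> \<in> borel_measurable borel" and f: "f \<in> borel_measurable borel"
  shows "aipw_score \<pi> f \<in> borel_measurable borel"
proof -
  have [measurable]: "f \<in> borel_measurable (borel \<Otimes>\<^sub>M borel)" using f by (simp add: borel_prod)
  show ?thesis unfolding aipw_score_def borel_prod[symmetric] by measurable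
qed

lemma sqrt_scaled_mean_diff:
  "sqrt (real (card I)) * (1 / real (card I) * (\<Sum>i\<in>I. s i) - \<theta>) = (\<Sum>i\<in>I. s i - \<theta>) / sqrt (card I)"
proof (cases "card I = 0")
  \<comment> \<open>\<open>card I\<close> is 0 for infinite as well as for empty \<open>I\<close>.
    The left side then has the factor \<open>sqrt 0\<close> and the right side is a division by 0,
    so both are 0.\<close>
  case True
  then show ?thesis by (cases "finite I") auto
next
  case False
  then have pos: "0 < sqrt (card I)" by simp
  have card: "real (card I) = sqrt (card I) * sqrt (card I)" by simp
  have "(\<Sum>i\<in>I. s i - \<theta>) = (\<Sum>i\<in>I. s i) - real (card I) * \<theta>" by (simp add: sum_subtractf)
  moreover have "q * (1 / (q * q) * S - \<theta>) = (S - q * q * \<theta>) / q" if "0 < q" for q S :: real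
    using that by (simp add: field_simps)
  from this[OF pos, of "\<Sum>i\<in>I. s i", folded card]
  have "sqrt (card I) * (1 / real (card I) * (\<Sum>i\<in>I. s i) - \<theta>) = ((\<Sum>i\<in>I. s i) - real (card I) * \<theta>) / sqrt (card I)" .
  ultimately show ?thesis by simp
qed

text \<open>Letting \<open>mu_est\<close> see only the observations restricted to
  \<open>I' n \<omega>\<close> encodes that the fit uses the training sample alone. Consistency is
  stated with nonnegative integrals, so an infinite error cannot be read as 0.
  \<open>finite_variance\<close> ensures that the Bochner integral defining the limiting variance is
  not a default value.\<close>

theorem proposition3:
  fixes Q :: "'w measure"
    and M A Ms :: "nat \<Rightarrow> 'w \<Rightarrow> real"
    and X :: "nat \<Rightarrow> 'w \<Rightarrow> real ^ 'k"
    and U :: "nat \<Rightarrow> 'w \<Rightarrow> real ^ 'l"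
    and W :: "nat \<Rightarrow> 'w \<Rightarrow> ('k, 'l) obs"
    and P :: "('k, 'l) obs measure"
    and PX :: "('k, 'l) features measure"
    and \<pi> :: "real ^ 'k \<Rightarrow> real"
    and \<mu> :: "('k, 'l) features \<Rightarrow> real"
    and \<theta> \<eta> :: real
    and I I' :: "nat \<Rightarrow> 'w \<Rightarrow> nat set"
    and N N' :: "nat \<Rightarrow> nat"
    and mu_est :: "nat \<Rightarrow> nat set \<Rightarrow> (nat \<Rightarrow> ('k, 'l) obs) \<Rightarrow> ('k, 'l) features \<Rightarrow> real"
    and mu_hat :: "nat \<Rightarrow> 'w \<Rightarrow> ('k, 'l) features \<Rightarrow> real"
    and theta_hat :: "nat \<Rightarrow> 'w \<Rightarrow> real"
  assumes prob: "prob_space Q"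
    and Ms_meas: "\<And>i. Ms i \<in> borel_measurable Q"
    and W_eq: "\<And>i \<omega>. W i \<omega> = (M i \<omega>, A i \<omega>, X i \<omega>, U i \<omega>)"
    and W_meas: "\<And>i. W i \<in> borel_measurable Q"
    and W_indep: "prob_space.indep_vars Q (\<lambda>_. borel) W UNIV"
    and W_law: "\<And>i. distr Q borel (W i) = P"
    and PX_eq: "PX = distr P borel (\<lambda>(m, a, x, u). (x, u))"
    and M_int: "\<And>i. integrable Q (M i)"
    and theta: "\<And>i. \<theta> = prob_space.expectation Q (Ms i)"
    and mu: "\<And>i. is_cond_exp_fun (uniform_measure Q {\<omega> \<in> space Q. A i \<omega> = 1})
                    (M i) (\<lambda>\<omega>. (X i \<omega>, U i \<omega>)) \<mu>"
    and split: "random_split Q W I I' N N'"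
    and mu_est_meas: "\<And>n J. finite J \<Longrightarrow>
          (\<lambda>(w, v). mu_est n J w v) \<in> borel_measurable (PiM J (\<lambda>_. borel) \<Otimes>\<^sub>M borel)"
    and mu_hat: "\<And>n \<omega>. mu_hat n \<omega> = mu_est n (I' n \<omega>) (restrict (\<lambda>i. W i \<omega>) (I' n \<omega>))"
    and theta_hat: "\<And>n \<omega>. theta_hat n \<omega> =
          aipw_estimator \<pi> (mu_hat n \<omega>) (I n \<omega>) (\<lambda>i. W i \<omega>)"
    and ground_truth: "\<And>i. AE \<omega> in Q. M i \<omega> = A i \<omega> * Ms i \<omega> \<and> A i \<omega> \<in> {0, 1}"
    and cond_indep: "\<And>i. cond_indep_given Q (\<lambda>\<omega>. (U i \<omega>, Ms i \<omega>)) (A i) (X i)"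
    and score: "\<And>i. is_cond_exp_fun Q (indicat_real (A i -` {1})) (X i) \<pi>"
    and eta: "0 < \<eta>" "\<eta> < 1"
    and overlap: "\<And>x. \<pi> x \<in> {\<eta>..1}"
    and mu_hat_consistent:
          "(\<lambda>n. \<integral>\<^sup>+ \<omega>. (\<integral>\<^sup>+ v. ennreal ((mu_hat n \<omega> v - \<mu> v)\<^sup>2) \<partial>PX) \<partial>Q) \<longlonglongrightarrow> 0"
    and finite_variance: "integrable P (\<lambda>w. (influence_fun \<pi> \<mu> \<theta> w)\<^sup>2)"
    and sizes: "filterlim N at_top sequentially" "filterlim N' at_top sequentially"
  shows "weak_conv_m
           (\<lambda>n. distr Q borel (\<lambda>\<omega>. sqrt (real (card (I n \<omega>))) * (theta_hat n \<omega> - \<theta>)))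
           (normal_law 0 (prob_space.variance P (influence_fun \<pi> \<mu> \<theta>)))"
proof -
  interpret Q: prob_space Q by (rule prob)
  have \<pi> [measurable]: "\<pi> \<in> borel_measurable borel" using score by (simp add: is_cond_exp_fun_def)
  have \<mu> [measurable]: "\<mu> \<in> borel_measurable borel" using mu by (simp add: is_cond_exp_fun_def)
  have \<pi>_ge: "\<eta> \<le> \<pi> x" for x using overlap[of x] by simp
  have \<pi>_pos: "0 < \<pi> x" for x using \<pi>_ge[of x] eta by linarith
  have W [measurable]: "W i \<in> measurable Q (borel \<Otimes>\<^sub>M borel \<Otimes>\<^sub>M borel \<Otimes>\<^sub>M borel)" for i
    using W_meas[of i] by (simp add: borel_prod)
  have [measurable]: "M i \<in> borel_measurable Q" "A i \<in> borel_measurable Q"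
    "X i \<in> borel_measurable Q" "U i \<in> borel_measurable Q" "Ms i \<in> borel_measurable Q" for i
    using measurable_compose[OF W[of i], of fst borel]
      measurable_compose[OF W[of i], of "\<lambda>p. fst (snd p)" borel]
      measurable_compose[OF W[of i], of "\<lambda>p. fst (snd (snd p))" borel]
      measurable_compose[OF W[of i], of "\<lambda>p. snd (snd (snd p))" borel]
    by (simp_all add: W_eq Ms_meas)
  have P: "P = distr Q borel (W 0)" by (rule W_law[symmetric])
  have [measurable_cong]: "sets P = sets borel" unfolding P by simp
  interpret P: prob_space P unfolding P by (rule Q.prob_space_distr) (rule W_meas)
  have A01: "AE \<omega> in Q. A i \<omega> \<in> {0, 1}" for i using ground_truth[of i] by eventually_elim simp
  have UMs: "(\<lambda>\<omega>. (U 0 \<omega>, Ms 0 \<omega>)) \<in> borel_measurable Q"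
    unfolding borel_prod[symmetric] by measurable
  \<comment> \<open>The weighting lemmas are instantiated with \<open>Y = (U, Ms)\<close>,
    \<open>V = X\<close> and \<open>Z = A\<close>.\<close>
  note ipw = UMs \<open>X 0 \<in> borel_measurable Q\<close> \<open>A 0 \<in> borel_measurable Q\<close> cond_indep score eta(1) \<pi>_ge A01

  \<comment> \<open>Moments of the influence function and of the residual\<close>
  define \<psi> where "\<psi> = influence_fun \<pi> \<mu> \<theta>"
  define r where "r = (ipw_residual \<pi> :: _ \<Rightarrow> ('k, 'l) obs \<Rightarrow> real)"
  have \<psi>_meas [measurable]: "\<psi> \<in> borel_measurable borel"
    unfolding \<psi>_def influence_fun_def using aipw_score_measurable[OF \<pi> \<mu>] by simp
  have r_meas: "r f \<in> borel_measurable borel" if "f \<in> borel_measurable borel" for f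
  proof -
    have "r f = (\<lambda>w. aipw_score \<pi> f w - aipw_score \<pi> (\<lambda>_. 0) w)"
      by (simp add: fun_eq_iff aipw_score_diff r_def)
    then show ?thesis
      by (simp only:) (intro borel_measurable_diff aipw_score_measurable \<pi> that borel_measurable_const)
  qed

  \<comment> \<open>The residual does not involve the outcome, so the function given to the
    weighting lemma ignores its \<open>Ms\<close> component. Only \<open>r f\<close>, and not
    \<open>f\<close>, is known to be integrable.\<close>
  have r_mean: "(\<integral>v. r f v \<partial>P) = 0" if f: "f \<in> borel_measurable borel" and int: "integrable P (r f)" for f
  proof -
    have [measurable]: "f \<in> borel_measurable (borel \<Otimes>\<^sub>M borel)" using f by (simp add: borel_prod)
    have "(\<lambda>(x, u, m :: real). f (x, u)) \<in> borel_measurable (borel \<Otimes>\<^sub>M borel \<Otimes>\<^sub>M borel)"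
      by measurable
    then have k: "(\<lambda>(x, u, m). f (x, u)) \<in> borel_measurable (borel \<Otimes>\<^sub>M (borel :: ((real ^ 'l) \<times> real) measure))"
      by (simp add: borel_prod)
    have eq: "r f (W 0 \<omega>) = (1 - A 0 \<omega> / \<pi> (X 0 \<omega>)) * (\<lambda>(x, u, m). f (x, u)) (X 0 \<omega>, U 0 \<omega>, Ms 0 \<omega>)" for \<omega>
      by (simp add: r_def ipw_residual_def W_eq)
    have "integrable Q (\<lambda>\<omega>. r f (W 0 \<omega>))"
      using int r_meas[OF f] W_meas unfolding P by (simp add: integrable_distr_eq)
    then have "(\<integral>\<omega>. r f (W 0 \<omega>) \<partial>Q) = 0"
      unfolding eq by (rule ipw_residual_expectation[OF prob ipw k])
    then show ?thesis using r_meas[OF f] W_meas unfolding P by (simp add: integral_distr)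
  qed

  \<comment> \<open>The inverse probability weighted mean of \<open>M\<close> identifies
    \<open>\<theta>\<close>. Almost surely \<open>A * M = A * Ms\<close>, because \<open>A\<close>
    squared equals \<open>A\<close>, and the integrable \<open>M\<close> divided by
    \<open>\<eta>\<close> dominates.\<close>
  have ht: "integrable P (\<lambda>(m, a, x, u). a / \<pi> x * m)" "(\<integral>w. (\<lambda>(m, a, x, u). a / \<pi> x * m) w \<partial>P) = \<theta>"
  proof -
    have "(\<lambda>(x :: real ^ 'k, u :: real ^ 'l, m :: real). m) \<in> borel_measurable (borel \<Otimes>\<^sub>M borel \<Otimes>\<^sub>M borel)"
      by measurable
    then have k: "(\<lambda>(x, u, m). m) \<in> borel_measurable ((borel :: (real ^ 'k) measure) \<Otimes>\<^sub>M (borel :: ((real ^ 'l) \<times> real) measure))"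
      by (simp add: borel_prod)
    have ae: "AE \<omega> in Q. A 0 \<omega> / \<pi> (X 0 \<omega>) * Ms 0 \<omega> = A 0 \<omega> / \<pi> (X 0 \<omega>) * M 0 \<omega>"
      using ground_truth[of 0] by eventually_elim auto
    have le: "AE \<omega> in Q. norm (A 0 \<omega> / \<pi> (X 0 \<omega>) * M 0 \<omega>) \<le> norm (1 / \<eta> * M 0 \<omega>)"
      using A01[of 0]
    proof eventually_elim
      case (elim \<omega>)
      have "\<bar>A 0 \<omega> / \<pi> (X 0 \<omega>)\<bar> \<le> 1 / \<eta>"
        using elim \<pi>_ge[of "X 0 \<omega>"] \<pi>_pos[of "X 0 \<omega>"] eta by (auto intro!: frac_le)
      then have "\<bar>A 0 \<omega> / \<pi> (X 0 \<omega>)\<bar> * \<bar>M 0 \<omega>\<bar> \<le> \<bar>1 / \<eta>\<bar> * \<bar>M 0 \<omega>\<bar>"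
        using eta by (intro mult_right_mono) auto
      then show ?case by (simp only: abs_mult real_norm_def)
    qed
    have int: "integrable Q (\<lambda>\<omega>. A 0 \<omega> / \<pi> (X 0 \<omega>) * M 0 \<omega>)"
      by (rule Bochner_Integration.integrable_bound[OF _ _ le]) (use M_int in auto)
    have "(\<integral>\<omega>. A 0 \<omega> / \<pi> (X 0 \<omega>) * M 0 \<omega> \<partial>Q) = (\<integral>\<omega>. A 0 \<omega> / \<pi> (X 0 \<omega>) * Ms 0 \<omega> \<partial>Q)"
      by (rule integral_cong_AE) (use ae in auto)
    also have "\<dots> = \<theta>"
      using ipw_expectation(2)[OF prob ipw k] by (simp add: theta[of 0])
    finally have val: "(\<integral>\<omega>. A 0 \<omega> / \<pi> (X 0 \<omega>) * M 0 \<omega> \<partial>Q) = \<theta>" .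
    have hm: "(\<lambda>(m, a, x, u). a / \<pi> x * m) \<in> borel_measurable (borel :: ('k, 'l) obs measure)"
      unfolding borel_prod[symmetric] by measurable
    show "integrable P (\<lambda>(m, a, x, u). a / \<pi> x * m)" "(\<integral>w. (\<lambda>(m, a, x, u). a / \<pi> x * m) w \<partial>P) = \<theta>"
      unfolding P using int val
      by (simp_all only: integrable_distr_eq[OF W_meas hm] integral_distr[OF W_meas hm] W_eq prod.case)
  qed

  have \<psi>_sq: "integrable P (\<lambda>w. (\<psi> w)\<^sup>2)" using finite_variance by (simp add: \<psi>_def)
  have \<psi>_int: "integrable P \<psi>" by (rule P.square_integrable_imp_integrable[OF _ \<psi>_sq]) simp
  \<comment> \<open>\<open>\<mu>\<close> is not known to be integrable, so the mean is not computed
    term by term. Instead \<open>r \<mu>\<close> is written through \<open>\<psi>\<close> and the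
    weighted outcome, both integrable, and its mean is zero by \<open>r_mean\<close>.\<close>
  have \<psi>_mean: "(\<integral>w. \<psi> w \<partial>P) = 0"
  proof -
    have eq: "r \<mu> w = \<psi> w + \<theta> - (\<lambda>(m, a, x, u). a / \<pi> x * m) w" for w
      by (cases w) (simp add: r_def ipw_residual_def \<psi>_def influence_fun_def aipw_score_def algebra_simps)
    have "integrable P (r \<mu>)" unfolding eq using \<psi>_int ht(1) by simp
    from r_mean[OF \<mu> this] show ?thesis
      unfolding eq using \<psi>_int ht by (simp add: P.prob_space)
  qed
  have var: "P.variance \<psi> = (\<integral>w. (\<psi> w)\<^sup>2 \<partial>P)" by (simp add: \<psi>_mean)

  have r_sq: "(\<integral>\<^sup>+ w. ennreal ((r f w)\<^sup>2) \<partial>P) \<le> ennreal ((1 / \<eta>)\<^sup>2) * (\<integral>\<^sup>+ v. ennreal ((f v)\<^sup>2) \<partial>PX)"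
    if f [measurable]: "f \<in> borel_measurable borel" for f
  proof -
    have [measurable]: "f \<in> borel_measurable (borel \<Otimes>\<^sub>M borel)" using f by (simp add: borel_prod)
    have ae: "AE \<omega> in Q. (r f (W 0 \<omega>))\<^sup>2 \<le> (1 / \<eta>)\<^sup>2 * (f (X 0 \<omega>, U 0 \<omega>))\<^sup>2"
      using A01[of 0]
    proof eventually_elim
      case (elim \<omega>)
      \<comment> \<open>For \<open>A = 0\<close> the weight is 1, at most \<open>1 / \<eta>\<close>.
        For \<open>A = 1\<close> its absolute value is \<open>1 / \<pi> - 1\<close>, again at most
        \<open>1 / \<eta>\<close>.\<close>
      have "1 \<le> 1 / \<pi> (X 0 \<omega>)" using overlap[of "X 0 \<omega>"] \<pi>_pos[of "X 0 \<omega>"] by simp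
      moreover have "1 / \<pi> (X 0 \<omega>) \<le> 1 / \<eta>" using \<pi>_ge[of "X 0 \<omega>"] eta by (intro frac_le) auto
      ultimately have "\<bar>1 - A 0 \<omega> / \<pi> (X 0 \<omega>)\<bar> \<le> 1 / \<eta>" using elim by auto
      then have "(1 - A 0 \<omega> / \<pi> (X 0 \<omega>))\<^sup>2 \<le> (1 / \<eta>)\<^sup>2"
        using eta by (intro abs_le_square_iff[THEN iffD1]) simp
      then show ?case
        by (simp add: r_def ipw_residual_def W_eq power_mult_distrib mult_right_mono)
    qed
    have "(\<integral>\<^sup>+ w. ennreal ((r f w)\<^sup>2) \<partial>P) = (\<integral>\<^sup>+ \<omega>. ennreal ((r f (W 0 \<omega>))\<^sup>2) \<partial>Q)"
      unfolding P using r_meas[OF f] by (intro nn_integral_distr W_meas) simp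
    also have "\<dots> \<le> (\<integral>\<^sup>+ \<omega>. ennreal ((1 / \<eta>)\<^sup>2) * ennreal ((f (X 0 \<omega>, U 0 \<omega>))\<^sup>2) \<partial>Q)"
      by (rule nn_integral_mono_AE) (use ae in \<open>eventually_elim, simp add: ennreal_mult[symmetric] del: power_divide\<close>)
    also have "\<dots> = ennreal ((1 / \<eta>)\<^sup>2) * (\<integral>\<^sup>+ \<omega>. ennreal ((f (X 0 \<omega>, U 0 \<omega>))\<^sup>2) \<partial>Q)"
      by (rule nn_integral_cmult) measurable
    also have "(\<integral>\<^sup>+ \<omega>. ennreal ((f (X 0 \<omega>, U 0 \<omega>))\<^sup>2) \<partial>Q) = (\<integral>\<^sup>+ v. ennreal ((f v)\<^sup>2) \<partial>PX)"
    proof -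
      have proj: "(\<lambda>(m, a, x, u). (x, u)) \<in> measurable (borel :: ('k, 'l) obs measure) (borel :: ('k, 'l) features measure)"
        unfolding borel_prod[symmetric] by measurable
      have proj': "(\<lambda>(m, a, x, u). (x, u)) \<in> measurable P (borel :: ('k, 'l) features measure)"
        using proj by measurable
      have "(\<integral>\<^sup>+ v. ennreal ((f v)\<^sup>2) \<partial>PX) = (\<integral>\<^sup>+ w. ennreal ((f ((\<lambda>(m, a, x, u). (x, u)) w))\<^sup>2) \<partial>P)"
        unfolding PX_eq by (rule nn_integral_distr[OF proj']) simp
      also have "\<dots> = (\<integral>\<^sup>+ \<omega>. ennreal ((f ((\<lambda>(m, a, x, u). (x, u)) (W 0 \<omega>)))\<^sup>2) \<partial>Q)"
        unfolding P using proj by (intro nn_integral_distr W_meas) (simp add: measurable_compose[OF _ f])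
      finally show ?thesis by (simp add: W_eq)
    qed
    finally show ?thesis .
  qed

  \<comment> \<open>The remainder due to estimating the regression function\<close>
  define g where "g n J w = r (\<lambda>v. mu_est n J w v - \<mu> v)" for n J w
  have est_diff: "(\<lambda>(w, v). mu_est n J w v - \<mu> v) \<in> borel_measurable (PiM J (\<lambda>_. borel) \<Otimes>\<^sub>M borel)"
    if "finite J" for n J
  proof -
    note [measurable] = mu_est_meas[OF that, of n]
    show ?thesis by measurable
  qed
  have g_meas: "(\<lambda>(w, v). g n J w v) \<in> borel_measurable (PiM J (\<lambda>_. borel) \<Otimes>\<^sub>M borel)" if "finite J" for n J
    unfolding g_def r_def by (rule ipw_residual_measurable[OF \<pi> est_diff[OF that]])
  have diff_meas: "(\<lambda>v. mu_est n J w v - \<mu> v) \<in> borel_measurable borel"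
    if "finite J" "w \<in> space (PiM J (\<lambda>_. borel))" for n J w
    using measurable_Pair2[OF est_diff[OF that(1)] that(2)] by simp
  have g_mean: "(\<integral>v. g n J w v \<partial>P) = 0"
    if "finite J" "w \<in> space (PiM J (\<lambda>_. borel))" "integrable P (\<lambda>v. (g n J w v)\<^sup>2)" for n J w
  proof -
    have "g n J w \<in> borel_measurable P"
      using r_meas[OF diff_meas[OF that(1,2)]] unfolding g_def by measurable
    then have "integrable P (g n J w)" using that(3) by (rule P.square_integrable_imp_integrable)
    then show ?thesis unfolding g_def by (intro r_mean diff_meas that)
  qed

  define T where "T = (\<lambda>n \<omega>. (\<Sum>i\<in>I n \<omega>. \<psi> (W i \<omega>)) / sqrt (card (I n \<omega>)))"
  define R where "R = (\<lambda>n \<omega>. (\<Sum>i\<in>I n \<omega>. g n (I' n \<omega>) (restrict (\<lambda>i. W i \<omega>) (I' n \<omega>)) (W i \<omega>)) / sqrt (card (I n \<omega>)))"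
  have decomp: "sqrt (real (card (I n \<omega>))) * (theta_hat n \<omega> - \<theta>) = T n \<omega> + R n \<omega>" for n \<omega>
  proof -
    have "aipw_score \<pi> (mu_hat n \<omega>) w - \<theta> = \<psi> w + g n (I' n \<omega>) (restrict (\<lambda>i. W i \<omega>) (I' n \<omega>)) w" for w
      using aipw_score_diff[of \<pi> "mu_hat n \<omega>" w \<mu>]
      by (simp add: \<psi>_def influence_fun_def g_def r_def mu_hat)
    then show ?thesis
      by (simp only: theta_hat aipw_estimator_def sqrt_scaled_mean_diff T_def R_def sum.distrib add_divide_distrib)
  qed

  have R_meas: "R n \<in> borel_measurable Q"
    and R_sq: "(\<integral>\<^sup>+ \<omega>. ennreal ((R n \<omega>)\<^sup>2) \<partial>Q)
      \<le> (\<integral>\<^sup>+ \<omega>. \<integral>\<^sup>+ v. ennreal ((g n (I' n \<omega>) (restrict (\<lambda>i. W i \<omega>) (I' n \<omega>)) v)\<^sup>2) \<partial>P \<partial>Q)" for n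
    unfolding R_def
    using Q.nn_second_moment_cross_fit_le[where g = "g n" and n = n, OF split W_indep W_law g_meas g_mean]
    by simp_all
  have R_lim: "(\<lambda>n. \<integral>\<^sup>+ \<omega>. ennreal ((R n \<omega>)\<^sup>2) \<partial>Q) \<longlonglongrightarrow> 0"
  proof (rule tendsto_sandwich[OF _ _ tendsto_const])
    let ?e = "\<lambda>n. \<integral>\<^sup>+ \<omega>. (\<integral>\<^sup>+ v. ennreal ((mu_hat n \<omega> v - \<mu> v)\<^sup>2) \<partial>PX) \<partial>Q"
    have "(\<integral>\<^sup>+ \<omega>. ennreal ((R n \<omega>)\<^sup>2) \<partial>Q) \<le> ennreal ((1 / \<eta>)\<^sup>2) * ?e n" for n
    proof -
      let ?b = "\<lambda>\<omega>. \<integral>\<^sup>+ v. ennreal ((mu_hat n \<omega> v - \<mu> v)\<^sup>2) \<partial>PX"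
      have [measurable_cong]: "sets PX = sets borel" by (simp add: PX_eq)
      have "prob_space PX"
        unfolding PX_eq
      proof (rule P.prob_space_distr)
        have "(\<lambda>(m, a, x, u). (x, u)) \<in> measurable (borel :: ('k, 'l) obs measure) (borel :: ('k, 'l) features measure)"
          unfolding borel_prod[symmetric] by measurable
        then show "(\<lambda>(m, a, x, u). (x, u)) \<in> measurable P (borel :: ('k, 'l) features measure)" by measurable
      qed
      then interpret PX: prob_space PX .
      \<comment> \<open>Measurability of the inner error integral is what allows the constant to be
        taken out of the outer one. It is obtained for each fixed split and transferred to the
        random split.\<close>
      have bm: "?b \<in> borel_measurable Q"
      proof -
        let ?f = "\<lambda>J J' w. \<integral>\<^sup>+ v. ennreal ((mu_est n J' (restrict w J') v - \<mu> v)\<^sup>2) \<partial>PX"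
        have "?f J J' \<in> borel_measurable (PiM UNIV (\<lambda>_. borel))" if "finite J'" for J J' :: "nat set"
        proof -
          note [measurable] = est_diff[OF that, of n]
          have "(\<lambda>(w, v). mu_est n J' w v - \<mu> v) \<in> borel_measurable (PiM J' (\<lambda>_. borel) \<Otimes>\<^sub>M PX)"
            by measurable
          then have "(\<lambda>w. \<integral>\<^sup>+ v. ennreal ((mu_est n J' w v - \<mu> v)\<^sup>2) \<partial>PX) \<in> borel_measurable (PiM J' (\<lambda>_. borel))"
            by (intro PX.borel_measurable_nn_integral) (simp add: case_prod_beta)
          then show ?thesis
            by (rule measurable_compose[rotated]) (simp add: measurable_restrict_subset)
        qed
        then show ?thesis
          unfolding mu_hat
          by (intro Q.random_split_measurable_compose[OF split W_meas, where f = ?f]) auto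
      qed
      have "(\<integral>\<^sup>+ \<omega>. ennreal ((R n \<omega>)\<^sup>2) \<partial>Q) \<le> (\<integral>\<^sup>+ \<omega>. ennreal ((1 / \<eta>)\<^sup>2) * ?b \<omega> \<partial>Q)"
      proof (rule order_trans[OF R_sq], rule nn_integral_mono)
        fix \<omega> assume "\<omega> \<in> space Q"
        then have "finite (I' n \<omega>)" using split by (simp add: random_split_def)
        then have "(\<lambda>v. mu_est n (I' n \<omega>) (restrict (\<lambda>i. W i \<omega>) (I' n \<omega>)) v - \<mu> v) \<in> borel_measurable borel"
          by (rule diff_meas) (simp add: space_PiM)
        then show "(\<integral>\<^sup>+ v. ennreal ((g n (I' n \<omega>) (restrict (\<lambda>i. W i \<omega>) (I' n \<omega>)) v)\<^sup>2) \<partial>P) \<le> ennreal ((1 / \<eta>)\<^sup>2) * ?b \<omega>"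
          unfolding g_def mu_hat by (rule r_sq)
      qed
      also have "\<dots> = ennreal ((1 / \<eta>)\<^sup>2) * ?e n"
        by (rule nn_integral_cmult[OF bm])
      finally show ?thesis .
    qed
    then show "\<forall>\<^sub>F n in sequentially. (\<integral>\<^sup>+ \<omega>. ennreal ((R n \<omega>)\<^sup>2) \<partial>Q) \<le> ennreal ((1 / \<eta>)\<^sup>2) * ?e n" by simp
    show "(\<lambda>n. ennreal ((1 / \<eta>)\<^sup>2) * ?e n) \<longlonglongrightarrow> 0"
      using ennreal_tendsto_cmult[OF _ mu_hat_consistent, of "ennreal ((1 / \<eta>)\<^sup>2)"] by simp
  qed simp

  \<comment> \<open>The leading term and the limit law\<close>
  have T_meas: "T n \<in> borel_measurable Q"
    and T_law: "distr Q borel (T n) = distr Q borel (\<lambda>\<omega>. (\<Sum>i<N n. \<psi> (W i \<omega>)) / sqrt (N n))" for n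
    unfolding T_def using Q.distr_random_split_sum[OF split W_indep W_law \<psi>_meas, of n] by simp_all
  have clt: "weak_conv_m (\<lambda>n. distr Q borel (\<lambda>\<omega>. (\<Sum>i<n. \<psi> (W i \<omega>)) / sqrt n)) (normal_law 0 (P.variance \<psi>))"
  proof (rule Q.clt_normal_law)
    show "Q.indep_vars (\<lambda>_. borel) (\<lambda>i \<omega>. \<psi> (W i \<omega>)) UNIV"
      by (rule Q.indep_vars_compose2[OF W_indep]) simp
    fix i
    show "(\<integral>\<omega>. \<psi> (W i \<omega>) \<partial>Q) = 0" "integrable Q (\<lambda>\<omega>. (\<psi> (W i \<omega>))\<^sup>2)"
      "(\<integral>\<omega>. (\<psi> (W i \<omega>))\<^sup>2 \<partial>Q) = P.variance \<psi>"
      unfolding var using \<psi>_mean \<psi>_sq W_meas unfolding W_law[of i, symmetric]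
      by (simp_all add: integral_distr integrable_distr_eq)
    show "distr Q borel (\<lambda>\<omega>. \<psi> (W i \<omega>)) = distr P borel \<psi>"
      unfolding W_law[of i, symmetric] using W_meas by (simp add: distr_distr comp_def)
  qed
  \<comment> \<open>The limit along initial segments of length \<open>n\<close> is evaluated at the
    sizes \<open>N n\<close>, which tend to infinity.\<close>
  have T_conv: "weak_conv_m (\<lambda>n. distr Q borel (T n)) (normal_law 0 (P.variance \<psi>))"
    unfolding T_law by (rule weak_conv_m_compose[OF clt sizes(1)])
  have "weak_conv_m (\<lambda>n. distr Q borel (\<lambda>\<omega>. T n \<omega> + R n \<omega>)) (normal_law 0 (P.variance \<psi>))"
    by (rule Q.weak_conv_m_add_null[OF T_meas R_meas _ T_conv Q.nn_integral_abs_tendsto_0[OF R_meas R_lim]])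
      (rule real_distribution_normal_law[OF P.variance_positive])
  then show ?thesis unfolding decomp \<psi>_def .
qed

end
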